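(* Suppose $n\in\mathbb Z^+$, $g,d,k,l\in\mathbb Z^{\ge0}$ with $n-k\in2\mathbb Z$, $\mathbf a\in(\mathbb Z^+-2\mathbb Z)^k$, $\mathbf b,\mathbf p\in(\mathbb Z^{\ge0})^l$, and $\phi=\tau_n'$, or $n\in2\mathbb Z$ and $\phi=\eta_n$. If $\phi=\tau_n'$, assume that $\sum_ia_i\equiv n$ (mod 2) and $\sum_ia_i^2\equiv\sum_ia_i$ (mod 4); if $\phi=\eta_n$, assume that $\sum_ia_i\equiv n$ (mod 4). If $(\Gamma,\sigma_1)$ and $(\Gamma,\sigma_2)$ are elements of $\mathcal A_{g,l}(n,d)$ such that $k\,\mathfrak g(v)=0$ for all vertices $v$ of $\Gamma$, $$\mathrm E_{\mathbb R}^{\sigma_1}(\Gamma)\supset\mathrm E_{\mathbb R}^{\sigma_2}(\Gamma),\qquad\text{and}\qquad\big|\mathrm E_{\mathbb R}^{\sigma_1}(\Gamma)-\mathrm E_{\mathbb R}^{\sigma_2}(\Gamma)\big|=2,$$ then (after restriction to the subtorus $\mathbb T^m\subset\mathbb T^n$) $$\mathfrak d(e^* )\,\big|\mathrm{Aut}(\Gamma,\sigma_1)\big|\,\mathrm{Cntr}_{(\Gamma,\sigma_1)}(\mathbf b,\mathbf p)=-\big|\mathrm{Aut}(\Gamma,\sigma_2)\big|\,\mathrm{Cntr}_{(\Gamma,\sigma_2)}(\mathbf b,\mathbf p),$$ where $e^*$ is one of the elements of $\mathrm E_{\mathbb R}^{\sigma_1}(\Gamma)-\mathrm E_{\mathbb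 R}^{\sigma_2}(\Gamma)$.
   Context: Let $m=\lfloor n/2\rfloor$, $[n]=\{1,\ldots,n\}$, and let $\phi:[n]\to[n]$ also denote the involution interchanging $2i-1$ and $2i$ for $i\le m$ and fixing $n$ if $n$ is odd; $|\phi|=0$ if $\phi=\tau_n'$ (the involution of $\mathbb P^{n-1}$ induced by $(v_1,\ldots,v_n)\mapsto(\bar v_2,\bar v_1,\bar v_4,\bar v_3,\ldots)$, with last coordinate $\bar v_n$ if $n$ is odd) and $|\phi|=1$ if $\phi=\eta_n$ (induced by $(v_1,\ldots,v_n)\mapsto(\bar v_2,-\bar v_1,\ldots,\bar v_n,-\bar v_{n-1})$). $\alpha_1,\ldots,\alpha_n$ are the weights of the standard $\mathbb T^n$-action on $\mathbb C^n$; $P_i\in\mathbb P^{n-1}$ is the $i$-th coordinate point, $\mathbf e$ is the equivariant Euler class, $\mathbf e(T_{P_i}\mathbb P^{n-1})=\prod_{j\ne i}(\alpha_i-\alpha_j)$. Restriction to $\mathbb T^m$ means setting $(\alpha_1,\ldots,\alpha_n)=(\lambda_1,-\lambda_1,\ldots,\lambda_m,-\lambda_m)$, followed by $0$ if $n$ is odd, with $\lambda_1,\ldots,\lambda_m$ independent variables. Graphs. A graph $(\mathrm{Ver},\mathrm{Edg})$ has a finite vertex set and a finite multiset of edges, which are two-element subsets of $\mathrm{Ver}$; for $v\in e$, $e/v$ is the other vertex. Its automorphisms are bijections $h$ of $\mathrm{Ver}\sqcup\mathrm{Edg}$ preserving $\mathrm{Ver}$ and incidence. Let $S_l=\{1^\pm,\ldots,l^\pm\}$.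 An $S_l$-marked $[n]$-labeled decorated graph is $\Gamma=(\mathrm{Ver},\mathrm{Edg},\mathfrak g,\vartheta,\mathfrak d,\mathfrak m)$ with $\mathfrak g:\mathrm{Ver}\to\mathbb Z^{\ge0}$, $\vartheta:\mathrm{Ver}\to[n]$, $\mathfrak d:\mathrm{Edg}\to\mathbb Z^+$, $\mathfrak m:S_l\to\mathrm{Ver}$, and $\vartheta(v)\ne\vartheta(e/v)$ for $v\in e$. $g(\Gamma)=|\mathrm{Edg}|-|\mathrm{Ver}|+1+\sum_v\mathfrak g(v)$, $d(\Gamma)=\sum_e\mathfrak d(e)$, $\mathrm E_v(\Gamma)=\{e:v\in e\}$, $\mathrm{val}_v(\Gamma)=2\mathfrak g(v)+|\mathrm E_v(\Gamma)|+|\mathfrak m^{-1}(v)|$. An involution $\sigma$ on $\Gamma$ is an automorphism of the graph and of $S_l$ with $\sigma(i^\pm)=i^\mp$, $\sigma^2=\mathrm{id}$, $\mathfrak g\circ\sigma=\mathfrak g$, $\vartheta\circ\sigma=\phi\circ\vartheta$, $\mathfrak d\circ\sigma=\mathfrak d$, $\sigma\circ\mathfrak m=\mathfrak m\circ\sigma$. $\mathrm E_{\mathbb R}^\sigma(\Gamma)$ is the set of $\sigma$-fixed edges and $\mathrm E_{\mathbb C}^\sigma(\Gamma)$ its complement in $\mathrm{Edg}$. $\mathrm{Aut}(\Gamma,\sigma)$ is the group of graph automorphisms preserving $\mathfrak g,\vartheta,\mathfrak d,\mathfrak m$ and commuting with $\sigma$. $\mathcal A_{g,l}(n,d)$ is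 the set of pairs $(\Gamma,\sigma)$ with $\Gamma$ connected, $g(\Gamma)=g$, $d(\Gamma)=d$, $\mathfrak d(e)\notin2\mathbb Z$ for all $e\in\mathrm E_{\mathbb R}^\sigma(\Gamma)$, and $\vartheta(v)\ne2m+1$ for all $v\in\mathrm{Ver}$ (so $\sigma$ fixes no vertex). Choose $\mathrm V_+^\sigma(\Gamma)\subset\mathrm{Ver}$ with $\mathrm{Ver}=\mathrm V_+^\sigma\sqcup\sigma(\mathrm V_+^\sigma)$ and $\mathrm E_+^\sigma(\Gamma)\subset\mathrm E_{\mathbb C}^\sigma(\Gamma)$ with $\mathrm E_{\mathbb C}^\sigma=\mathrm E_+^\sigma\sqcup\sigma(\mathrm E_+^\sigma)$. Define $$\mathrm{Cntr}_{(\Gamma,\sigma)}(\mathbf b,\mathbf p)=\frac1{|\mathrm{Aut}(\Gamma,\sigma)|}\prod_{v\in\mathrm V_+^\sigma(\Gamma)}(-1)^{\mathfrak s_v}\mathrm{Cntr}_{(\Gamma,\sigma);v}(\mathbf b,\mathbf p)\prod_{e\in\mathrm E_{\mathbb R}^\sigma(\Gamma)\sqcup\mathrm E_+^\sigma(\Gamma)}\mathrm{Cntr}_{(\Gamma,\sigma);e},$$ restricted to $\mathbb T^m$; under the stated assumptions it does not depend on the choices of $\mathrm V_+^\sigma(\Gamma)$, $\mathrm E_+^\sigma(\Gamma)$, or of the ordering of the vertices of each edge. Vertex factors. $S_v=\mathrm E_v(\Gamma)\sqcup\mathfrak m^{-1}(v)$, $S_v^-=\{i:i^-\in S_v\}$,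 $|\mathbf b|_v=\sum_{i^\pm\in S_v}b_i$, $|\mathbf p|_v=\sum_{i^\pm\in S_v}p_i$ (one term for each marked element of $S_v$), $\mathfrak s_v=\mathfrak g(v)-1+|\mathrm E_v(\Gamma)|+\sum_{i\in S_v^-}(1+b_i+p_i)$, $\psi_{e;v}=(\alpha_{\vartheta(e/v)}-\alpha_{\vartheta(v)})/\mathfrak d(e)$, $\langle\mathbf a\rangle=a_1\cdots a_k$, $|\mathbf a|=a_1+\cdots+a_k$. With $\mathbb E\to\overline{\mathcal M}_{g',S}$ the Hodge bundle and $\psi_e,\psi_i$ the usual $\psi$-classes, if $\mathrm{val}_v\ge3$, $$\mathrm{Cntr}_{(\Gamma,\sigma);v}=\Big(\tfrac{\mathbf e(T_{P_{\vartheta(v)}}\mathbb P^{n-1})}{\langle\mathbf a\rangle\alpha_{\vartheta(v)}^k}\Big)^{|\mathrm E_v(\Gamma)|-1}\alpha_{\vartheta(v)}^{|\mathbf p|_v}\int_{\overline{\mathcal M}_{\mathfrak g(v),S_v}}\frac{\mathbf e(\mathbb E^*\otimes T_{P_{\vartheta(v)}}\mathbb P^{n-1})}{\prod_{e\in\mathrm E_v(\Gamma)}\psi_{e;v}(\psi_{e;v}+\psi_e)}\prod_{i^\pm\in S_v}\psi_i^{b_i};$$ if $\mathrm{val}_v=1,2$, $$\mathrm{Cntr}_{(\Gamma,\sigma);v}=-(-1)^{\mathrm{val}_v}\Big(\tfrac{\mathbf e(T_{P_{\vartheta(v)}}\mathbb P^{n-1})}{\langle\mathbf a\rangle\alpha_{\vartheta(v)}^k}\Big)^{|\mathrm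 E_v(\Gamma)|-1}\alpha_{\vartheta(v)}^{|\mathbf p|_v}\Big(\prod_{e\in\mathrm E_v(\Gamma)}\psi_{e;v}\Big)^{-1}\Big(\sum_{e\in\mathrm E_v(\Gamma)}\psi_{e;v}\Big)^{3-\mathrm{val}_v-|\mathrm E_v(\Gamma)|+|\mathbf b|_v}.$$ Edge factors. Let $e=\{v_1,v_2\}$, $\delta=\mathfrak d(e)$, $\alpha=\alpha_{\vartheta(v_1)}$, $\alpha'=\alpha_{\vartheta(v_2)}$. Condition (C): $n=2m+1$, $\delta\in2\mathbb Z$, and $\vartheta(v_1)=\phi(\vartheta(v_2))$. For $e\in\mathrm E_{\mathbb C}^\sigma(\Gamma)$ satisfying (C) (then $k\ge1$), $\mathrm{Cntr}_{(\Gamma,\sigma);e}=0$ if $k\ge2$, and if $k=1$ $$\mathrm{Cntr}_{(\Gamma,\sigma);e}=\frac{(-1)^{(a_1+1)\delta/2}}{\delta}\,\frac{a_1((a_1\delta/2)!)^2}{((\delta/2)!)^2(\delta!)^2}\,\frac{(2\alpha/\delta)^{(a_1-3)\delta+2}}{\prod_{1\le j<n,\,j\ne\vartheta(v_1),\vartheta(v_2)}\big(\alpha_j\prod_{r=1}^{\delta/2}(r^2(2\alpha/\delta)^2-\alpha_j^2)\big)}.$$ For $e\in\mathrm E_{\mathbb C}^\sigma(\Gamma)$ not satisfying (C), $$\mathrm{Cntr}_{(\Gamma,\sigma);e}=\frac{(-1)^\delta}{\delta(\delta!)^2}\,\frac{\prod_{i=1}^k\prod_{r=0}^{a_i\delta}\frac{(a_i\delta-r)\alpha+r\alpha'}{\delta}}{\big(\frac{\alpha-\alpha'}{\delta}\big)^{2\delta-2}\prod_{j\ne\vartheta(v_1),\vartheta(v_2)}\prod_{r=0}^{\delta}\big(\frac{(\delta-r)\alpha+r\alpha'}{\delta}-\alpha_j\big)}.$$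 For $e\in\mathrm E_{\mathbb R}^\sigma(\Gamma)$ (all $a_i$ being odd here), $$\mathrm{Cntr}_{(\Gamma,\sigma);e}=\frac{(-1)^{|\phi|+\frac{\delta-1}2}}{\delta}\,\frac{\prod_{i=1}^k(a_i\delta)!!}{2^{\delta-1}\delta!}\,\frac{(\alpha/\delta)^{\frac{(|\mathbf a|-2)\delta+k}2+1}}{\prod_{j\ne\vartheta(v_1),\vartheta(v_2)}\prod_{r=0}^{(\delta-1)/2}\big(\frac{(\delta-2r)\alpha}{\delta}-\alpha_j\big)}.$$
   Formalization: For φ=η_n it is additionally assumed that the contribution of (Γ,σ_1) does not depend on the ordering of the vertices of each edge; this can fail as stated (e.g. n=4, k=2, a=(1,3), two parallel degree 1 edges), making the contribution ill-defined. *)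

theory Defs
  imports
    Complex_Main
    "HOL-Library.Poly_Mapping"
    "HOL-Computational_Algebra.Fraction_Field"
    "HOL-Number_Theory.Cong"
    "HOL-Combinatorics.Permutations"
begin

section \<open>Weights\<close>

text \<open>The field of rational functions over the rationals in variables
  $\lambda_1,\lambda_2,\ldots$; only $\lambda_1,\ldots,\lambda_m$ are used.\<close>

type_synonym ratfun = "((nat \<Rightarrow>\<^sub>0 nat) \<Rightarrow>\<^sub>0 rat) fract"

definition lambda_var :: "nat \<Rightarrow> ratfun" where
  "lambda_var i = Fract (Poly_Mapping.single (Poly_Mapping.single i 1) 1) 1"

text \<open>The weight $\alpha_j$, $1\le j\le n$, already restricted to the subtorus
  $\mathbb T^m$, $m=\lfloor n/2\rfloor$. No denominator in the formulas below restricts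
  to 0 for the labels and edges they are used for, so restricting first is the same as
  restricting at the end.\<close>

definition alpha :: "nat \<Rightarrow> nat \<Rightarrow> ratfun" where
  "alpha n j = (if odd n \<and> j = n then 0
                else if odd j then lambda_var ((j + 1) div 2)
                else - lambda_var (j div 2))"

text \<open>The two types of anti-holomorphic involutions on $\mathbb P^{n-1}$, that is
  $\tau_n'$ and $\eta_n$; the induced involution on $[n]$ is the same for both.\<close>

datatype real_inv = Tau | Eta

fun inv_sgn :: "real_inv \<Rightarrow> nat" where
  "inv_sgn Tau = 0"
| "inv_sgn Eta = 1"

definition phi :: "nat \<Rightarrow> nat \<Rightarrow> nat" where
  "phi n i = (if odd n \<and> i = n then n else if odd i then i + 1 else i - 1)"

fun dfact :: "nat \<Rightarrow> nat" where
  "dfact 0 = 1"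
| "dfact (Suc 0) = 1"
| "dfact (Suc (Suc r)) = Suc (Suc r) * dfact r"


section \<open>Intersection theory on the moduli spaces of stable curves\<close>

text \<open>
  The spaces $\overline{\mathcal M}_{g,S}$ are not available as an object of the library.
  The integrals over them are written out below in terms of the even-degree cohomology with
  coefficients in the field of rational functions, the classes $\psi_s$ and
  $\lambda_q=c_q(\mathbb E)$, and integration against the fundamental class. Only the
  standard properties of these collected in the locale below are assumed.
  They hold for the actual moduli spaces, and nothing requires that they characterize them:
  a statement about an arbitrary \<open>M\<close> satisfying them includes the geometric one.

  In the intended model, the ring \<open>'h\<close> is the direct product of the rings
  $H^{2*}(\overline{\mathcal M}_{g,S})$ over all stable pairs $(g,S)$. The classes
  $\psi_s$ and $\lambda_q$, $q>0$, of $\overline{\mathcal M}_{g,S}$ are placed in the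
  $(g,S)$ factor, \<open>integ g S\<close> is the integral of the $(g,S)$ component,
  and \<open>hdeg d\<close> is the product of the groups
  $H^{2d}(\overline{\mathcal M}_{g,S})$.
\<close>

record ('s, 'h) mbar =
  scal :: "ratfun \<Rightarrow> 'h"
  hdeg :: "nat \<Rightarrow> 'h set"
  psi :: "nat \<Rightarrow> 's set \<Rightarrow> 's \<Rightarrow> 'h"
  lam :: "nat \<Rightarrow> 's set \<Rightarrow> nat \<Rightarrow> 'h"
  integ :: "nat \<Rightarrow> 's set \<Rightarrow> 'h \<Rightarrow> ratfun"

definition stable :: "nat \<Rightarrow> 's set \<Rightarrow> bool" where
  "stable g S \<longleftrightarrow> finite S \<and> 2 * g + card S \<ge> 3"

locale mbar_theory =
  fixes M :: "('s, 'h::comm_ring_1) mbar"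
  assumes scal_1: "scal M 1 = 1"
    and scal_add: "scal M (x + y) = scal M x + scal M y"
    and scal_mult: "scal M (x * y) = scal M x * scal M y"
    and scal_hdeg: "scal M x \<in> hdeg M 0"
    and add_hdeg: "c \<in> hdeg M r \<Longrightarrow> c' \<in> hdeg M r \<Longrightarrow> c + c' \<in> hdeg M r"
    and mult_hdeg: "c \<in> hdeg M r \<Longrightarrow> c' \<in> hdeg M r' \<Longrightarrow> c * c' \<in> hdeg M (r + r')"
    and psi_hdeg: "stable g S \<Longrightarrow> s \<in> S \<Longrightarrow> psi M g S s \<in> hdeg M 1"
    and psi_nilpotent: "stable g S \<Longrightarrow> s \<in> S \<Longrightarrow> psi M g S s ^ (3 * g + card S - 2) = 0"
    and lam_hdeg: "stable g S \<Longrightarrow> lam M g S q \<in> hdeg M q"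
    and lam_0: "stable g S \<Longrightarrow> lam M g S 0 = 1"
    and lam_top: "stable g S \<Longrightarrow> q > g \<Longrightarrow> lam M g S q = 0"
    and integ_add: "stable g S \<Longrightarrow> integ M g S (c + c') = integ M g S c + integ M g S c'"
    and integ_scal: "stable g S \<Longrightarrow> integ M g S (scal M x * c) = x * integ M g S c"
    and integ_dim:
      "stable g S \<Longrightarrow> c \<in> hdeg M r \<Longrightarrow> r + 3 \<noteq> 3 * g + card S \<Longrightarrow> integ M g S c = 0"
    and relabel: "stable g S \<Longrightarrow> bij_betw f S S' \<Longrightarrow>
      \<exists>\<rho>. (\<forall>c c'. \<rho> (c + c') = \<rho> c + \<rho> c') \<and> (\<forall>c c'. \<rho> (c * c') = \<rho> c * \<rho> c') \<and>
          (\<forall>x. \<rho> (scal M x) = scal M x) \<and>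
          (\<forall>s\<in>S. \<rho> (psi M g S s) = psi M g S' (f s)) \<and>
          (\<forall>q. \<rho> (lam M g S q) = lam M g S' q) \<and>
          (\<forall>c. integ M g S' (\<rho> c) = integ M g S c)"

definition unit_inv :: "'h::comm_ring_1 \<Rightarrow> 'h" where
  "unit_inv u = (THE w. u * w = 1)"

text \<open>$\mathbf e(\mathbb E^*\otimes T_{P_i}\mathbb P^{n-1})$: the tangent space is the sum of
  lines of weights $\alpha_i-\alpha_j$, and
  $\mathbf e(\mathbb E^*\otimes L)=\sum_q(-1)^q\lambda_q\,\mathbf e(L)^{g-q}$
  for a line $L$.\<close>

definition euler_hodge ::
    "('s, 'h::comm_ring_1) mbar \<Rightarrow> nat \<Rightarrow> nat \<Rightarrow> 's set \<Rightarrow> nat \<Rightarrow> 'h" where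
  "euler_hodge M n g S i =
     (\<Prod>j\<in>{1..n} - {i}. \<Sum>q\<le>g. (- 1) ^ q * lam M g S q * scal M ((alpha n i - alpha n j) ^ (g - q)))"

definition euler_tangent :: "nat \<Rightarrow> nat \<Rightarrow> ratfun" where
  "euler_tangent n i = (\<Prod>j\<in>{1..n} - {i}. alpha n i - alpha n j)"


section \<open>Decorated graphs with involutions\<close>

text \<open>Edges are named, so that there may be several with the same endpoints. The marks
  $i^+$ and $i^-$ are \<open>(i, True)\<close> and \<open>(i, False)\<close>.\<close>

record ('v, 'e) dgraph =
  Ver :: "'v set"
  Edg :: "'e set"
  ends :: "'e \<Rightarrow> 'v set"
  genus :: "'v \<Rightarrow> nat"
  lab :: "'v \<Rightarrow> nat"
  edeg :: "'e \<Rightarrow> nat"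
  mark :: "nat \<times> bool \<Rightarrow> 'v"

definition marks :: "nat \<Rightarrow> (nat \<times> bool) set" where
  "marks l = {1..l} \<times> UNIV"

definition opp :: "('v, 'e) dgraph \<Rightarrow> 'e \<Rightarrow> 'v \<Rightarrow> 'v" where
  "opp G e v = (THE w. ends G e = {v, w})"

definition is_dgraph :: "nat \<Rightarrow> nat \<Rightarrow> ('v, 'e) dgraph \<Rightarrow> bool" where
  "is_dgraph n l G \<longleftrightarrow>
     finite (Ver G) \<and> finite (Edg G) \<and>
     (\<forall>e\<in>Edg G. ends G e \<subseteq> Ver G \<and> card (ends G e) = 2 \<and> edeg G e > 0 \<and>
        (\<forall>v\<in>ends G e. lab G v \<noteq> lab G (opp G e v))) \<and>
     lab G ` Ver G \<subseteq> {1..n} \<and>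
     mark G ` marks l \<subseteq> Ver G"

definition connected_graph :: "('v, 'e) dgraph \<Rightarrow> bool" where
  "connected_graph G \<longleftrightarrow> Ver G \<noteq> {} \<and>
     (\<forall>v\<in>Ver G. \<forall>w\<in>Ver G. (v, w) \<in> {(x, y). \<exists>e\<in>Edg G. ends G e = {x, y}}\<^sup>*)"

definition graph_genus :: "('v, 'e) dgraph \<Rightarrow> int" where
  "graph_genus G = int (card (Edg G)) - int (card (Ver G)) + 1 + int (\<Sum>v\<in>Ver G. genus G v)"

definition graph_degree :: "('v, 'e) dgraph \<Rightarrow> nat" where
  "graph_degree G = (\<Sum>e\<in>Edg G. edeg G e)"

definition edges_at :: "('v, 'e) dgraph \<Rightarrow> 'v \<Rightarrow> 'e set" where
  "edges_at G v = {e \<in> Edg G. v \<in> ends G e}"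

definition marks_at :: "nat \<Rightarrow> ('v, 'e) dgraph \<Rightarrow> 'v \<Rightarrow> (nat \<times> bool) set" where
  "marks_at l G v = {x \<in> marks l. mark G x = v}"

definition flags_at :: "nat \<Rightarrow> ('v, 'e) dgraph \<Rightarrow> 'v \<Rightarrow> ('e + nat \<times> bool) set" where
  "flags_at l G v = edges_at G v <+> marks_at l G v"

definition valence :: "nat \<Rightarrow> ('v, 'e) dgraph \<Rightarrow> 'v \<Rightarrow> nat" where
  "valence l G v = 2 * genus G v + card (edges_at G v) + card (marks_at l G v)"

text \<open>A bijection of the vertices and edges is a pair of permutations; \<open>permutes\<close> makes
  both trivial outside of the graph, so that each automorphism is represented once.\<close>

definition graph_aut :: "('v, 'e) dgraph \<Rightarrow> ('v \<Rightarrow> 'v) \<times> ('e \<Rightarrow> 'e) \<Rightarrow> bool" where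
  "graph_aut G h \<longleftrightarrow> fst h permutes Ver G \<and> snd h permutes Edg G \<and>
     (\<forall>e\<in>Edg G. ends G (snd h e) = fst h ` ends G e)"

definition is_involution ::
    "nat \<Rightarrow> nat \<Rightarrow> ('v, 'e) dgraph \<Rightarrow> ('v \<Rightarrow> 'v) \<times> ('e \<Rightarrow> 'e) \<Rightarrow> bool" where
  "is_involution n l G \<sigma> \<longleftrightarrow> graph_aut G \<sigma> \<and>
     (\<forall>v\<in>Ver G. fst \<sigma> (fst \<sigma> v) = v \<and> genus G (fst \<sigma> v) = genus G v \<and>
        lab G (fst \<sigma> v) = phi n (lab G v)) \<and>
     (\<forall>e\<in>Edg G. snd \<sigma> (snd \<sigma> e) = e \<and> edeg G (snd \<sigma> e) = edeg G e) \<and>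
     (\<forall>(i, s)\<in>marks l. fst \<sigma> (mark G (i, s)) = mark G (i, \<not> s))"

definition real_edges :: "('v, 'e) dgraph \<Rightarrow> ('v \<Rightarrow> 'v) \<times> ('e \<Rightarrow> 'e) \<Rightarrow> 'e set" where
  "real_edges G \<sigma> = {e \<in> Edg G. snd \<sigma> e = e}"

definition complex_edges :: "('v, 'e) dgraph \<Rightarrow> ('v \<Rightarrow> 'v) \<times> ('e \<Rightarrow> 'e) \<Rightarrow> 'e set" where
  "complex_edges G \<sigma> = Edg G - real_edges G \<sigma>"

definition Aut :: "nat \<Rightarrow> ('v, 'e) dgraph \<Rightarrow> ('v \<Rightarrow> 'v) \<times> ('e \<Rightarrow> 'e) \<Rightarrow>
    (('v \<Rightarrow> 'v) \<times> ('e \<Rightarrow> 'e)) set" where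
  "Aut l G \<sigma> = {h. graph_aut G h \<and>
     (\<forall>v\<in>Ver G. genus G (fst h v) = genus G v \<and> lab G (fst h v) = lab G v \<and>
        fst h (fst \<sigma> v) = fst \<sigma> (fst h v)) \<and>
     (\<forall>e\<in>Edg G. edeg G (snd h e) = edeg G e \<and> snd h (snd \<sigma> e) = snd \<sigma> (snd h e)) \<and>
     (\<forall>x\<in>marks l. fst h (mark G x) = mark G x)}"

definition admissible_pairs :: "nat \<Rightarrow> nat \<Rightarrow> nat \<Rightarrow> nat \<Rightarrow>
    (('v, 'e) dgraph \<times> (('v \<Rightarrow> 'v) \<times> ('e \<Rightarrow> 'e))) set" where
  "admissible_pairs g l n d = {(G, \<sigma>).
     is_dgraph n l G \<and> is_involution n l G \<sigma> \<and> connected_graph G \<and>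
     graph_genus G = int g \<and> graph_degree G = d \<and>
     (\<forall>e\<in>real_edges G \<sigma>. odd (edeg G e)) \<and>
     (\<forall>v\<in>Ver G. lab G v \<noteq> 2 * (n div 2) + 1)}"


section \<open>Contributions of the fixed loci\<close>

definition psi_edge :: "nat \<Rightarrow> ('v, 'e) dgraph \<Rightarrow> 'e \<Rightarrow> 'v \<Rightarrow> ratfun" where
  "psi_edge n G e v = (alpha n (lab G (opp G e v)) - alpha n (lab G v)) / of_nat (edeg G e)"

definition mark_sum :: "(nat \<Rightarrow> nat) \<Rightarrow> nat \<Rightarrow> ('v, 'e) dgraph \<Rightarrow> 'v \<Rightarrow> nat" where
  "mark_sum b l G v = (\<Sum>x\<in>marks_at l G v. b (fst x))"

definition sgn_exp :: "(nat \<Rightarrow> nat) \<Rightarrow> (nat \<Rightarrow> nat) \<Rightarrow> nat \<Rightarrow> ('v, 'e) dgraph \<Rightarrow> 'v \<Rightarrow> int" where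
  "sgn_exp b p l G v = int (genus G v) - 1 + int (card (edges_at G v))
     + (\<Sum>i | (i, False) \<in> marks_at l G v. 1 + int (b i) + int (p i))"

definition Cntr_vertex :: "('e + nat \<times> bool, 'h::comm_ring_1) mbar \<Rightarrow> nat \<Rightarrow> nat \<Rightarrow> (nat \<Rightarrow> nat) \<Rightarrow>
    (nat \<Rightarrow> nat) \<Rightarrow> (nat \<Rightarrow> nat) \<Rightarrow> nat \<Rightarrow> ('v, 'e) dgraph \<Rightarrow> 'v \<Rightarrow> ratfun" where
  "Cntr_vertex M n k a b p l G v =
     (let g = genus G v; i = lab G v; E = edges_at G v; S = flags_at l G v; val = valence l G v;
          pre = (euler_tangent n i / (of_nat (\<Prod>r=1..k. a r) * alpha n i ^ k)) powi (int (card E) - 1)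
                * alpha n i ^ mark_sum p l G v
      in if val \<ge> 3 then
           pre * integ M g S
             (euler_hodge M n g S i
              * unit_inv (\<Prod>e\<in>E. scal M (psi_edge n G e v) * (scal M (psi_edge n G e v) + psi M g S (Inl e)))
              * (\<Prod>x\<in>marks_at l G v. psi M g S (Inr x) ^ b (fst x)))
         else
           - ((- 1) ^ val) * pre * inverse (\<Prod>e\<in>E. psi_edge n G e v)
             * (\<Sum>e\<in>E. psi_edge n G e v) powi (3 - int val - int (card E) + int (mark_sum b l G v)))"

text \<open>In the three edge factors, \<open>i\<close> and \<open>i'\<close> are the labels of the first and the
  second vertex of the edge and \<open>t\<close> is its degree.

  The factor \<open>Cntr_edge_special\<close> already is a restriction to the subtorus: some factors
  of the denominator of \<open>Cntr_edge_complex\<close> restrict to 0 in the case it covers.\<close>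

definition Cntr_edge_special ::
    "nat \<Rightarrow> nat \<Rightarrow> (nat \<Rightarrow> nat) \<Rightarrow> nat \<Rightarrow> nat \<Rightarrow> nat \<Rightarrow> ratfun" where
  "Cntr_edge_special n k a t i i' =
     (if k = 1 then
        (- 1) ^ ((a 1 + 1) * (t div 2)) / of_nat t
        * (of_nat (a 1 * (fact (a 1 * (t div 2)))\<^sup>2) / of_nat ((fact (t div 2))\<^sup>2 * (fact t)\<^sup>2))
        * ((2 * alpha n i / of_nat t) powi ((int (a 1) - 3) * int t + 2)
           / (\<Prod>j\<in>{1..<n} - {i, i'}. alpha n j *
                (\<Prod>r=1..t div 2. of_nat (r\<^sup>2) * (2 * alpha n i / of_nat t)\<^sup>2 - (alpha n j)\<^sup>2)))
      else 0)"

definition Cntr_edge_complex ::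
    "nat \<Rightarrow> nat \<Rightarrow> (nat \<Rightarrow> nat) \<Rightarrow> nat \<Rightarrow> nat \<Rightarrow> nat \<Rightarrow> ratfun" where
  "Cntr_edge_complex n k a t i i' =
     (- 1) ^ t / of_nat (t * (fact t)\<^sup>2)
     * ((\<Prod>c=1..k. \<Prod>r=0..a c * t.
           (of_nat (a c * t - r) * alpha n i + of_nat r * alpha n i') / of_nat t)
        / (((alpha n i - alpha n i') / of_nat t) ^ (2 * t - 2)
           * (\<Prod>j\<in>{1..n} - {i, i'}. \<Prod>r=0..t.
                (of_nat (t - r) * alpha n i + of_nat r * alpha n i') / of_nat t - alpha n j)))"

text \<open>The exponent $((|\mathbf a|-2)\delta+k)/2+1$ is an integer for odd $a_c$ and $\delta$.\<close>

definition Cntr_edge_real ::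
    "real_inv \<Rightarrow> nat \<Rightarrow> nat \<Rightarrow> (nat \<Rightarrow> nat) \<Rightarrow> nat \<Rightarrow> nat \<Rightarrow> nat \<Rightarrow> ratfun" where
  "Cntr_edge_real \<phi> n k a t i i' =
     (- 1) ^ (inv_sgn \<phi> + (t - 1) div 2) / of_nat t
     * (of_nat (\<Prod>c=1..k. dfact (a c * t)) / of_nat (2 ^ (t - 1) * fact t))
     * ((alpha n i / of_nat t) powi ((((\<Sum>c=1..k. int (a c)) - 2) * int t + int k) div 2 + 1)
        / (\<Prod>j\<in>{1..n} - {i, i'}. \<Prod>r=0..(t - 1) div 2.
             (of_int (int t - 2 * int r) * alpha n i) / of_nat t - alpha n j))"

definition Cntr_edge :: "real_inv \<Rightarrow> nat \<Rightarrow> nat \<Rightarrow> (nat \<Rightarrow> nat) \<Rightarrow> ('v, 'e) dgraph \<Rightarrow>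
    ('v \<Rightarrow> 'v) \<times> ('e \<Rightarrow> 'e) \<Rightarrow> ('e \<Rightarrow> 'v) \<Rightarrow> 'e \<Rightarrow> ratfun" where
  "Cntr_edge \<phi> n k a G \<sigma> ori e =
     (let t = edeg G e; i = lab G (ori e); i' = lab G (opp G e (ori e))
      in if e \<in> real_edges G \<sigma> then Cntr_edge_real \<phi> n k a t i i'
         else if odd n \<and> even t \<and> i = phi n i' then Cntr_edge_special n k a t i i'
         else Cntr_edge_complex n k a t i i')"

text \<open>The choices entering the definition of the contribution of $(\Gamma,\sigma)$: a set
  \<open>Vp\<close> of representatives of the vertices and a set \<open>Ep\<close> of representatives
  of the non-fixed edges modulo $\sigma$, and the first vertex \<open>ori e\<close> of each edge.\<close>

record ('v, 'e) choices =
  Vp :: "'v set"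
  Ep :: "'e set"
  ori :: "'e \<Rightarrow> 'v"

definition valid_choices ::
    "('v, 'e) dgraph \<Rightarrow> ('v \<Rightarrow> 'v) \<times> ('e \<Rightarrow> 'e) \<Rightarrow> ('v, 'e) choices \<Rightarrow> bool" where
  "valid_choices G \<sigma> c \<longleftrightarrow>
     Ver G = Vp c \<union> fst \<sigma> ` Vp c \<and> Vp c \<inter> fst \<sigma> ` Vp c = {} \<and>
     complex_edges G \<sigma> = Ep c \<union> snd \<sigma> ` Ep c \<and> Ep c \<inter> snd \<sigma> ` Ep c = {} \<and>
     (\<forall>e\<in>Edg G. ori c e \<in> ends G e)"

definition Cntr :: "('e + nat \<times> bool, 'h::comm_ring_1) mbar \<Rightarrow> real_inv \<Rightarrow> nat \<Rightarrow> nat \<Rightarrow> (nat \<Rightarrow> nat) \<Rightarrow>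
    nat \<Rightarrow> (nat \<Rightarrow> nat) \<Rightarrow> (nat \<Rightarrow> nat) \<Rightarrow> ('v, 'e) dgraph \<Rightarrow> ('v \<Rightarrow> 'v) \<times> ('e \<Rightarrow> 'e) \<Rightarrow>
    ('v, 'e) choices \<Rightarrow> ratfun" where
  "Cntr M \<phi> n k a l b p G \<sigma> c =
     1 / of_nat (card (Aut l G \<sigma>))
     * (\<Prod>v\<in>Vp c. (- 1) powi sgn_exp b p l G v * Cntr_vertex M n k a b p l G v)
     * (\<Prod>e\<in>real_edges G \<sigma> \<union> Ep c. Cntr_edge \<phi> n k a G \<sigma> (ori c) e)"

text \<open>Independence of the ordering of the vertices of the edges. For \<open>Tau\<close> it follows from
  the congruences imposed on $\mathbf a$. For \<open>Eta\<close>, $n$ even, $|\mathbf a|\equiv n$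
  (mod 4) and odd $a_c$, reversing a fixed edge multiplies its factor by $(-1)^{(n+k)/2}$,
  so that the contribution is well-defined only if $k\equiv n$ (mod 4) or it
  vanishes. A complete intersection preserved by $\eta_n$ always has $k\equiv|\mathbf a|$
  (mod 4), since the odd degrees $a_c$ occur in equal pairs.\<close>

definition Cntr_order_independent :: "('e + nat \<times> bool, 'h::comm_ring_1) mbar \<Rightarrow> real_inv \<Rightarrow>
    nat \<Rightarrow> nat \<Rightarrow> (nat \<Rightarrow> nat) \<Rightarrow> nat \<Rightarrow> (nat \<Rightarrow> nat) \<Rightarrow> (nat \<Rightarrow> nat) \<Rightarrow> ('v, 'e) dgraph \<Rightarrow>
    ('v \<Rightarrow> 'v) \<times> ('e \<Rightarrow> 'e) \<Rightarrow> bool" where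
  "Cntr_order_independent M \<phi> n k a l b p G \<sigma> \<longleftrightarrow>
     (\<forall>c c'. valid_choices G \<sigma> c \<longrightarrow> valid_choices G \<sigma> c' \<longrightarrow> Vp c = Vp c' \<longrightarrow> Ep c = Ep c' \<longrightarrow>
        Cntr M \<phi> n k a l b p G \<sigma> c = Cntr M \<phi> n k a l b p G \<sigma> c')"

end

theory Submission
  imports Defs
begin

text \<open>
  The involution on labels negates the restricted weights. By homogeneity and relabelling
  invariance, the signed factor of a vertex is therefore constant on the orbits of
  either involution, and the product over one representative of each orbit depends only on how
  often each value occurs, not on the involution. The same holds for the factors of complex edges,
  so the second involution contributes one additional complex edge factor, that of \<open>e'\<close>, in
  place of the two real ones. A counting argument modulo 2 shows that the two edges in question have
  the same degree and labels. The real factors of \<open>e'\<close> for its two orientations multiply to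
  $-1/\mathfrak d(e')$ times its complex factor, because the
  products over $0\le r\le\delta$ in the complex factor split into two opposite halves.
  Reversing real edges changes nothing in the case \<open>Tau\<close>; in the case \<open>Eta\<close> it can produce a
  sign, but then order independence makes both sides vanish.
\<close>

text \<open>The two involutions may act differently far away from the two special edges, so their
  representatives need not correspond to each other. Counting how often a value occurs replaces a
  correspondence: a value taken \<open>2 * c\<close> times on the whole graph is taken
  \<open>c\<close> times on every transversal.

  The relation \<open>sign_pair\<close> avoids both problems. It allows any splitting, and
  integration then retains a single degree, where the sign is a constant.

  The condition \<open>k * genus G v = 0\<close> is a parity condition in disguise: the Hodge
  classes contribute the sign (-1)^(n g), and \<open>n\<close> has the parity of \<open>k\<close>.
  The remaining sign of a vertex depends only on its marks and is the one that
  \<open>sgn_exp\<close> compensates.\<close>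

lemma minus_one_powi: "(- 1 :: 'a::field) powi z = (if even z then 1 else - 1)"
  by (cases z rule: int_cases2) (auto simp: power_int_minus minus_one_power_iff)

lemma minus_powi: "(- x :: 'a::field) powi z = (- 1) powi z * x powi z"
  by (metis mult_minus1 power_int_mult_distrib)

lemma minus_one_power_cong: "even (r + s) \<Longrightarrow> (- 1 :: 'a::ring_1) ^ r = (- 1) ^ s"
  by (simp add: minus_one_power_iff)

section \<open>Weights\<close>

lemma of_nat_ratfun_eq_0_iff [simp]: "of_nat r = (0 :: ratfun) \<longleftrightarrow> r = 0"
  by (simp add: of_nat_fract Zero_fract_def eq_fract)

lemma lambda_var_neq_0: "lambda_var i \<noteq> 0"
proof -
  have "Poly_Mapping.keys (Poly_Mapping.single (Poly_Mapping.single i (1::nat)) (1::rat)) \<noteq>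
    Poly_Mapping.keys 0"
    unfolding keys_single by simp
  then have "Poly_Mapping.single (Poly_Mapping.single i (1::nat)) (1::rat) \<noteq> 0" by metis
  then show ?thesis by (simp add: lambda_var_def Zero_fract_def eq_fract)
qed

lemma lambda_var_eq_iff: "lambda_var i = lambda_var j \<longleftrightarrow> i = j"
proof
  assume "lambda_var i = lambda_var j"
  then have "Poly_Mapping.single (Poly_Mapping.single i (1::nat)) (1::rat) =
      Poly_Mapping.single (Poly_Mapping.single j 1) 1"
    by (simp add: lambda_var_def eq_fract)
  then have "Poly_Mapping.keys (Poly_Mapping.single (Poly_Mapping.single i (1::nat)) (1::rat)) =
      Poly_Mapping.keys (Poly_Mapping.single (Poly_Mapping.single j (1::nat)) (1::rat))" by simp
  then have "Poly_Mapping.single i (1::nat) = Poly_Mapping.single j 1" by simp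
  then have "Poly_Mapping.keys (Poly_Mapping.single i (1::nat)) = Poly_Mapping.keys
    (Poly_Mapping.single j (1::nat))" by simp
  then show "i = j" by simp
qed simp

text \<open>The coefficient of the i-th variable is 1 on the left and -1 or 0 on the right.\<close>

lemma lambda_var_neq_minus: "lambda_var i \<noteq> - lambda_var j"
proof
  let ?x = "\<lambda>i. Poly_Mapping.single (Poly_Mapping.single i (1::nat)) (1::rat)"
  assume "lambda_var i = - lambda_var j"
  then have "?x i = - ?x j"
    by (simp add: lambda_var_def eq_fract)
  then have "Poly_Mapping.lookup (?x i) (Poly_Mapping.single i 1) = Poly_Mapping.lookup (- ?x j)
    (Poly_Mapping.single i 1)"
    by simp
  then show False
    by (simp only: lookup_single lookup_uminus when_def) (simp split: if_splits)
qed

lemma phi_range: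
  assumes "i \<in> {1..n}"
  shows "phi n i \<in> {1..n}"
proof -
  \<comment> \<open>The only label whose successor leaves the range is \<open>n\<close>, and for
    even \<open>n\<close> it is even, so \<open>phi\<close> lowers it.\<close>
  have "i \<noteq> n" if "odd i" "even n" using that by auto
  then show ?thesis using assms by (auto simp: phi_def elim!: evenE)
qed

lemma phi_phi: "i \<in> {1..n} \<Longrightarrow> phi n (phi n i) = i"
  by (cases "even i"; cases "even n") (auto simp: phi_def elim!: evenE oddE)

text \<open>For odd \<open>n\<close> the excluded label \<open>2 * (n div 2) + 1\<close> is the
  fixed label \<open>n\<close>; for even \<open>n\<close> it is \<open>n + 1\<close> and lies
  outside of the range anyway.\<close>

lemma phi_neq: "i \<in> {1..n} \<Longrightarrow> i \<noteq> 2 * (n div 2) + 1 \<Longrightarrow> phi n i \<noteq> i"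
  by (auto simp: phi_def) 

lemma bij_betw_phi: "bij_betw (phi n) {1..n} {1..n}"
  by (rule bij_betwI[where g = "phi n"]) (use phi_range phi_phi in blast)+

text \<open>Every product over the remaining labels is compared with its version for negated weights
  by reindexing along this bijection.\<close>

lemma bij_betw_phi_diff:
  assumes "A \<subseteq> {1..n}"
  shows "bij_betw (phi n) ({1..n} - A) ({1..n} - phi n ` A)"
  using bij_betw_phi[of n] assms
  by (metis bij_betw_def bij_betw_subset Diff_subset inj_on_image_set_diff)

text \<open>The fixed label of odd \<open>n\<close> is covered as well, since its weight is
  0.\<close>

lemma alpha_phi: "i \<in> {1..n} \<Longrightarrow> alpha n (phi n i) = - alpha n i"
proof -
  have "(2 * r - 1) div 2 + 1 = r" if "1 \<le> 2 * r" for r :: nat using that by presburger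
  then show "i \<in> {1..n} \<Longrightarrow> alpha n (phi n i) = - alpha n i"
    by (cases "even i") (auto simp: phi_def alpha_def elim!: evenE oddE simp flip: One_nat_def)
qed

lemma alpha_neq_0: "i \<in> {1..n} \<Longrightarrow> i \<noteq> 2 * (n div 2) + 1 \<Longrightarrow> alpha n i \<noteq> 0"
  by (auto simp: alpha_def lambda_var_neq_0)

text \<open>Restriction to the subtorus identifies no two weights; this keeps
  \<open>psi_edge\<close> invertible.\<close>

lemma alpha_eq_iff:
  assumes "i \<in> {1..n}" "j \<in> {1..n}"
  shows "alpha n i = alpha n j \<longleftrightarrow> i = j"
proof -
  have "lambda_var r \<noteq> 0" "- lambda_var r \<noteq> 0" "lambda_var r \<noteq> - lambda_var s" for r s
    by (simp_all add: lambda_var_neq_0 lambda_var_neq_minus)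
  note neq = this this[symmetric]
  show ?thesis
  proof
    assume eq: "alpha n i = alpha n j"
    show "i = j"
    proof (cases "odd n \<and> (i = n \<or> j = n)")
      case True
      then show ?thesis using eq by (auto simp: alpha_def neq split: if_splits)
    next
      case False
      then have "odd i = odd j" "(if odd i then (i + 1) div 2 else i div 2) = (if odd i then (j
        + 1) div 2 else j div 2)"
        using eq by (auto simp: alpha_def neq lambda_var_eq_iff split: if_splits)
      then show ?thesis by (auto split: if_splits elim!: evenE oddE)
    qed
  qed simp
qed

lemma euler_tangent_phi:
  assumes "i \<in> {1..n}"
  shows "euler_tangent n (phi n i) = (- 1) ^ (n - 1) * euler_tangent n i"
proof -
  have "euler_tangent n (phi n i) = (\<Prod>j\<in>{1..n} - {i}. alpha n (phi n i) - alpha n (phi n j))"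
    unfolding euler_tangent_def
    using assms by (intro prod.reindex_bij_betw[symmetric]) (use bij_betw_phi_diff[of "{i}" n]
      in simp)
  also have "\<dots> = (\<Prod>j\<in>{1..n} - {i}. - 1 * (alpha n i - alpha n j))"
    using assms by (intro prod.cong) (auto simp: alpha_phi)
  also have "\<dots> = (- 1) ^ (n - 1) * euler_tangent n i"
    using assms unfolding prod.distrib euler_tangent_def by simp
  finally show ?thesis .
qed

section \<open>Products over representatives of the orbits of an involution\<close>

text \<open>The index set \<open>Y\<close> may contain values that are not attained, with exponent
  0, so that products over different sets can be compared exponent by exponent.\<close>

lemma prod_group_by_value:
  assumes "finite B" "F ` B \<subseteq> Y" "finite Y"
  shows "(\<Prod>x\<in>B. F x) = (\<Prod>y\<in>Y. y ^ card {x \<in> B. F x = y})"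
proof -
  have "(\<Prod>x\<in>B. F x) = (\<Prod>y\<in>Y. \<Prod>x\<in>{x \<in> B. F x = y}. F x)"
    using prod.group[OF assms(1,3,2), of F] by simp
  also have "\<dots> = (\<Prod>y\<in>Y. y ^ card {x \<in> B. F x = y})"
    by (intro prod.cong refl) simp
  finally show ?thesis .
qed

text \<open>Since \<open>F\<close> is constant on orbits and \<open>B\<close> is disjoint from its
  image, each fibre of \<open>F\<close> consists of two-element orbits with exactly one member in
  \<open>B\<close>.\<close>

lemma card_fibre_transversal:
  assumes "finite A" "A = B \<union> s ` B" "B \<inter> s ` B = {}"
    and "\<And>x. x \<in> A \<Longrightarrow> s (s x) = x" "\<And>x. x \<in> A \<Longrightarrow> F (s x) = F x"
  shows "card {x \<in> A. F x = y} = 2 * card {x \<in> B. F x = y}"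
proof -
  let ?C = "{x \<in> B. F x = y}"
  have "finite B" using assms by auto
  have "inj_on s ?C"
    by (rule inj_on_inverseI[where g = s]) (use assms in auto)
  have "{x \<in> A. F x = y} = ?C \<union> s ` ?C" using assms by auto
  moreover have "?C \<inter> s ` ?C = {}" using assms(3) by auto
  ultimately show ?thesis
    using \<open>finite B\<close> \<open>inj_on s ?C\<close> by (simp add: card_Un_disjoint card_image)
qed

text \<open>The right side mentions neither \<open>B\<close> nor \<open>s\<close>, which allows
  transversals of two different involutions to be compared.\<close>

lemma prod_transversal:
  assumes "finite A" "A = B \<union> s ` B" "B \<inter> s ` B = {}"
    and "\<And>x. x \<in> A \<Longrightarrow> s (s x) = x" "\<And>x. x \<in> A \<Longrightarrow> F (s x) = F x"
    and "F ` A \<subseteq> Y" "finite Y"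
  shows "(\<Prod>x\<in>B. F x) = (\<Prod>y\<in>Y. y ^ (card {x \<in> A. F x = y} div 2))"
proof -
  have "(\<Prod>x\<in>B. F x) = (\<Prod>y\<in>Y. y ^ card {x \<in> B. F x = y})"
    using assms by (intro prod_group_by_value) auto
  also have "\<dots> = (\<Prod>y\<in>Y. y ^ (card {x \<in> A. F x = y} div 2))"
    using card_fibre_transversal[where F = F, OF assms(1-5)] by simp
  finally show ?thesis .
qed

section \<open>Reversing the signs of the weights in an integral\<close>

text \<open>Replacing every weight by its negative turns a class \<open>x\<close>, homogeneous of degree
  congruent to \<open>\<epsilon>\<close> modulo 2 in the weights and cohomology classes together, into \<open>y\<close>: a
  component of cohomological degree \<open>r\<close> is multiplied by $(-1)^{\epsilon+r}$.\<close>

inductive sign_pair :: "('s, 'h::comm_ring_1) mbar \<Rightarrow> nat \<Rightarrow> 'h \<Rightarrow> 'h \<Rightarrow> bool"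
  for M \<epsilon> where
  hdeg: "c \<in> hdeg M r \<Longrightarrow> sign_pair M \<epsilon> c ((- 1) ^ (\<epsilon> + r) * c)"
| add: "sign_pair M \<epsilon> x y \<Longrightarrow> sign_pair M \<epsilon> x' y' \<Longrightarrow> sign_pair M \<epsilon> (x + x') (y + y')"

lemma sign_pair_cong: "sign_pair M \<epsilon> x y \<Longrightarrow> even (\<epsilon> + \<epsilon>') \<Longrightarrow> sign_pair M \<epsilon>' x y"
proof (induction rule: sign_pair.induct)
  case (hdeg c r)
  then have "even ((\<epsilon> + r) + (\<epsilon>' + r))" by presburger
  from minus_one_power_cong[OF this] sign_pair.hdeg[OF hdeg(1), of \<epsilon>'] show ?case by metis
qed (rule sign_pair.add)

lemma unit_inv_eq:
  assumes "u * w = 1"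
  shows "unit_inv u = w"
  unfolding unit_inv_def
proof (rule the_equality)
  fix w' assume "u * w' = 1"
  then have "w' = (u * w) * w'" using assms by simp
  also have "\<dots> = w * (u * w')" by (simp add: ac_simps)
  finally show "w' = w" using \<open>u * w' = 1\<close> by simp
qed (fact assms)

text \<open>The expansion of 1/(z + x) as a geometric series in x/z, made finite by nilpotency of
  \<open>x\<close>; multiplied out, it telescopes.\<close>

lemma geometric_inverse:
  fixes x :: "'a::comm_ring_1"
  assumes "x ^ N = 0" "z * z' = 1"
  shows "(z + x) * (\<Sum>r<N. (- x) ^ r * z' ^ (r + 1)) = 1"
proof -
  have "(z + x) * (\<Sum>r<N. (- x) ^ r * z' ^ (r + 1)) =
      (\<Sum>r<N. (- (x * z')) ^ r - (- (x * z')) ^ Suc r)"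
    unfolding sum_distrib_left
  proof (rule sum.cong[OF refl])
    fix r
    have "(z + x) * ((- x) ^ r * z' ^ (r + 1)) = (z * z' + x * z') * (- x * z') ^ r"
      by (simp only: power_mult_distrib mult_minus_left[symmetric] power_Suc
        Suc_eq_plus1[symmetric]) (simp add: algebra_simps)
    then show "(z + x) * ((- x) ^ r * z' ^ (r + 1)) = (- (x * z')) ^ r - (- (x * z')) ^ Suc r"
      using assms(2) by (simp add: algebra_simps)
  qed
  also have "\<dots> = 1 - (- (x * z')) ^ N"
    unfolding sum_lessThan_telescope' by simp
  also have "(- (x * z')) ^ N = (- z') ^ N * x ^ N"
    by (metis mult.commute mult_minus_right power_mult_distrib)
  finally show ?thesis using assms(1) by simp
qed

context mbar_theory
begin

lemma scal_0: "scal M 0 = 0"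
  using scal_add[of 0 0] by simp

lemma scal_minus: "scal M (- x) = - scal M x"
proof -
  have "scal M (- x) + scal M x = 0" using scal_add[of "- x" x] scal_0 by simp
  then show ?thesis by (rule eq_neg_iff_add_eq_0[THEN iffD2])
qed

lemma scal_power: "scal M (x ^ r) = scal M x ^ r"
  by (induction r) (simp_all add: scal_1 scal_mult)

lemma scal_minus_one_power: "scal M ((- 1) ^ r) = (- 1) ^ r"
  by (simp add: scal_power scal_minus scal_1)

lemma integ_sign: "stable g S \<Longrightarrow> integ M g S ((- 1) ^ r * c) = (- 1) ^ r * integ M g S c"
  using integ_scal[of g S "(- 1) ^ r" c] by (simp add: scal_minus_one_power)

lemma sign_pair_mult:
  assumes "sign_pair M \<epsilon> x y" "sign_pair M \<epsilon>' x' y'"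
  shows "sign_pair M (\<epsilon> + \<epsilon>') (x * x') (y * y')"
  using assms
proof (induction rule: sign_pair.induct)
  case (hdeg c r)
  from hdeg(2) show ?case
  proof (induction rule: sign_pair.induct)
    case (hdeg c' r')
    from mult_hdeg[OF \<open>c \<in> hdeg M r\<close> hdeg]
    have "sign_pair M (\<epsilon> + \<epsilon>') (c * c') ((- 1) ^ (\<epsilon> + \<epsilon>' + (r + r')) * (c * c'))"
      by (rule sign_pair.hdeg)
    then show ?case by (simp add: power_add ac_simps)
  next
    case (add x y x' y')
    then show ?case using sign_pair.add by (fastforce simp: distrib_left)
  qed
next
  case (add x1 y1 x2 y2)
  then show ?case using sign_pair.add by (fastforce simp: distrib_right)
qed

text \<open>In applications \<open>\<epsilon>\<close> has the parity of the degree of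
  \<open>x\<close> in the weights, and the second scalar is then \<open>x\<close> with all weights
  negated.\<close>

lemma sign_pair_scal: "sign_pair M \<epsilon> (scal M x) (scal M ((- 1) ^ \<epsilon> * x))"
  using sign_pair.hdeg[OF scal_hdeg, of \<epsilon> x] by (simp add: scal_mult scal_minus_one_power)

lemma sign_pair_1: "sign_pair M 0 1 1"
  using sign_pair_scal[of 0 1] by (simp add: scal_1)

lemma sign_pair_0: "sign_pair M \<epsilon> 0 0"
  using sign_pair_scal[of \<epsilon> 0] by (simp add: scal_0)

lemma sign_pair_sum:
  assumes "finite A" "\<And>i. i \<in> A \<Longrightarrow> sign_pair M \<epsilon> (f i) (h i)"
  shows "sign_pair M \<epsilon> (\<Sum>i\<in>A. f i) (\<Sum>i\<in>A. h i)"
  using assms by (induction A rule: finite_induct) (auto intro: sign_pair_0 sign_pair.add)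

lemma sign_pair_prod:
  assumes "finite A" "\<And>i. i \<in> A \<Longrightarrow> sign_pair M (\<epsilon> i) (f i) (h i)"
  shows "sign_pair M (\<Sum>i\<in>A. \<epsilon> i) (\<Prod>i\<in>A. f i) (\<Prod>i\<in>A. h i)"
  using assms by (induction A rule: finite_induct) (auto intro: sign_pair_1 sign_pair_mult)

lemma sign_pair_power: "sign_pair M \<epsilon> x y \<Longrightarrow> sign_pair M (\<epsilon> * r) (x ^ r) (y ^ r)"
  by (induction r) (auto intro: sign_pair_1 sign_pair_mult)

lemma sign_pair_psi: "stable g S \<Longrightarrow> s \<in> S \<Longrightarrow> sign_pair M 1 (psi M g S s) (psi M g S s)"
  using sign_pair.hdeg[OF psi_hdeg, of g S s 1] by simp

text \<open>Only degree r = 3g - 3 + |S| survives integration. It is congruent to g + |S| + 1 modulo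
  2, so the sign of the surviving component is known in advance.\<close>

lemma integ_sign_pair:
  assumes "stable g S" "sign_pair M \<epsilon> x y"
  shows "integ M g S y = (- 1) ^ (\<epsilon> + g + card S + 1) * integ M g S x"
  using assms(2)
proof (induction rule: sign_pair.induct)
  case (hdeg c r)
  show ?case
  proof (cases "r + 3 = 3 * g + card S")
    case True
    then have "even ((\<epsilon> + r) + (\<epsilon> + g + card S + 1))" by presburger
    then show ?thesis
      by (simp only: integ_sign[OF assms(1)] minus_one_power_cong)
  next
    case False
    from integ_dim[OF assms(1) hdeg False] show ?thesis
      by (simp add: integ_sign[OF assms(1)])
  qed
qed (simp add: integ_add[OF assms(1)] algebra_simps)

text \<open>The cutoff \<open>3 * g + card S - 2\<close> is one more than the dimension of the
  moduli space. Every term of the series has total degree r - (r + 1) = -1, whence the odd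
  parity.\<close>

lemma unit_inv_scal_add_psi:
  assumes "stable g S" "s \<in> S" "z \<noteq> 0"
  defines "w \<equiv> \<lambda>z. \<Sum>r<3 * g + card S - 2. (- psi M g S s) ^ r * scal M (inverse z) ^ (r + 1)"
  shows "(scal M z + psi M g S s) * w z = 1" "sign_pair M 1 (w z) (w (- z))"
proof -
  show "(scal M z + psi M g S s) * w z = 1"
    unfolding w_def
    by (intro geometric_inverse psi_nilpotent assms) (use assms(3) in \<open>simp flip: scal_mult add:
      scal_1\<close>)
  have neg: "sign_pair M 1 (- psi M g S s) (- psi M g S s)"
    using sign_pair_mult[OF sign_pair_scal[of 0 "- 1"] sign_pair_psi[OF assms(1,2)]]
    by (simp add: scal_minus scal_1)
  have inv: "sign_pair M 1 (scal M (inverse z)) (scal M (inverse (- z)))"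
    using sign_pair_scal[of 1 "inverse z"] by simp
  show "sign_pair M 1 (w z) (w (- z))"
    unfolding w_def
  proof (intro sign_pair_sum finite_lessThan)
    fix r
    show "sign_pair M 1 ((- psi M g S s) ^ r * scal M (inverse z) ^ (r + 1))
        ((- psi M g S s) ^ r * scal M (inverse (- z)) ^ (r + 1))"
      by (rule sign_pair_cong[OF sign_pair_mult[OF sign_pair_power[OF neg] sign_pair_power[OF
        inv]]])
        simp
  qed
qed

text \<open>Each edge contributes two factors of degree -1 to the inverse, so the total parity is
  even for any number of edges. The first claim records that the product is a unit, as required for
  transporting its inverse along a ring map.\<close>

lemma unit_inv_psi_product:
  assumes "stable g S" "finite E" "f ` E \<subseteq> S" "\<And>e. e \<in> E \<Longrightarrow> z e \<noteq> 0"
  defines "u \<equiv> \<lambda>z. \<Prod>e\<in>E. scal M (z e) * (scal M (z e) + psi M g S (f e))"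
  shows "u z * unit_inv (u z) = 1"
    and "sign_pair M 0 (unit_inv (u z)) (unit_inv (u (\<lambda>e. - z e)))"
proof -
  define w where "w e z = (\<Sum>r<3 * g + card S - 2.
    (- psi M g S (f e)) ^ r * scal M (inverse z) ^ (r + 1))" for e z
  let ?w = "\<lambda>z. \<Prod>e\<in>E. scal M (inverse (z e)) * w e (z e)"
  have inv: "u z * ?w z = 1" if "\<And>e. e \<in> E \<Longrightarrow> z e \<noteq> 0" for z
    unfolding u_def prod.distrib[symmetric]
  proof (rule prod.neutral, rule ballI)
    fix e assume e: "e \<in> E"
    have "scal M (z e) * (scal M (z e) + psi M g S (f e)) * (scal M (inverse (z e)) * w e (z e))
        = scal M (z e * inverse (z e)) * ((scal M (z e) + psi M g S (f e)) * w e (z e))"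
      unfolding scal_mult by (simp add: ac_simps)
    also have "(scal M (z e) + psi M g S (f e)) * w e (z e) = 1"
      unfolding w_def by (rule unit_inv_scal_add_psi) (use assms e that in auto)
    also have "z e * inverse (z e) = 1" using that e by simp
    finally show "scal M (z e) * (scal M (z e) + psi M g S (f e)) *
        (scal M (inverse (z e)) * w e (z e)) = 1"
      by (simp add: scal_1)
  qed
  have eq: "unit_inv (u z) = ?w z" "unit_inv (u (\<lambda>e. - z e)) = ?w (\<lambda>e. - z e)"
    by (intro unit_inv_eq inv; use assms(4) in simp)+
  show "u z * unit_inv (u z) = 1" using inv[of z] assms(4) eq by simp
  have "sign_pair M (\<Sum>e\<in>E. 1 + 1) (?w z) (?w (\<lambda>e. - z e))"
  proof (intro sign_pair_prod sign_pair_mult assms(2))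
    fix e assume "e \<in> E"
    then show "sign_pair M 1 (w e (z e)) (w e (- z e))"
      unfolding w_def by (intro unit_inv_scal_add_psi) (use assms in auto)
    show "sign_pair M 1 (scal M (inverse (z e))) (scal M (inverse (- z e)))"
      using sign_pair_scal[of 1 "inverse (z e)"] by simp
  qed
  then show "sign_pair M 0 (unit_inv (u z)) (unit_inv (u (\<lambda>e. - z e)))"
    unfolding eq by (rule sign_pair_cong) simp
qed

text \<open>Each of the n - 1 factors belongs to one line in the tangent space and is homogeneous of
  degree g: \<open>q\<close> comes from the Hodge class and \<open>g - q\<close> from the
  weight.\<close>

lemma sign_pair_euler_hodge:
  assumes "stable g S" "i \<in> {1..n}"
  shows "sign_pair M ((n - 1) * g) (euler_hodge M n g S i) (euler_hodge M n g S (phi n i))"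
proof -
  let ?f = "\<lambda>x. \<Sum>q\<le>g. (- 1) ^ q * lam M g S q * scal M (x ^ (g - q))"
  have "euler_hodge M n g S (phi n i) = (\<Prod>j\<in>{1..n} - {i}. ?f (alpha n (phi n i) - alpha n (phi n
    j)))"
    unfolding euler_hodge_def using assms
    by (intro prod.reindex_bij_betw[symmetric]) (use bij_betw_phi_diff[of "{i}" n] in simp)
  also have "\<dots> = (\<Prod>j\<in>{1..n} - {i}. ?f (- (alpha n i - alpha n j)))"
  proof (intro prod.cong refl)
    fix j assume "j \<in> {1..n} - {i}"
    then have "alpha n (phi n i) - alpha n (phi n j) = - (alpha n i - alpha n j)"
      using assms(2) alpha_phi[of i n] alpha_phi[of j n] by simp
    then show "?f (alpha n (phi n i) - alpha n (phi n j)) = ?f (- (alpha n i - alpha n j))" by simp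
  qed
  finally have eq: "euler_hodge M n g S (phi n i) =
      (\<Prod>j\<in>{1..n} - {i}. ?f (- (alpha n i - alpha n j)))" .
  have pair: "sign_pair M g (?f x) (?f (- x))" for x
  proof (intro sign_pair_sum finite_atMost)
    fix q assume "q \<in> {..g}"
    have "sign_pair M (0 + q + (g - q)) ((- 1) ^ q * lam M g S q * scal M (x ^ (g - q)))
        ((- 1) ^ q * lam M g S q * scal M ((- x) ^ (g - q)))"
    proof (intro sign_pair_mult)
      show "sign_pair M 0 ((- 1) ^ q) ((- 1) ^ q)"
        using sign_pair_scal[of 0 "(- 1) ^ q"] by (simp add: scal_minus_one_power)
      show "sign_pair M q (lam M g S q) (lam M g S q)"
        using sign_pair.hdeg[OF lam_hdeg[OF assms(1)], of q q] by (simp flip: mult_2)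
      show "sign_pair M (g - q) (scal M (x ^ (g - q))) (scal M ((- x) ^ (g - q)))"
        using sign_pair_scal[of "g - q" "x ^ (g - q)"] by (simp add: power_minus[of x])
    qed
    then show "sign_pair M g ((- 1) ^ q * lam M g S q * scal M (x ^ (g - q)))
        ((- 1) ^ q * lam M g S q * scal M ((- x) ^ (g - q)))"
      using \<open>q \<in> {..g}\<close> by simp
  qed
  have "sign_pair M (\<Sum>j\<in>{1..n} - {i}. g) (euler_hodge M n g S i) (euler_hodge M n g S (phi n i))"
    unfolding eq unfolding euler_hodge_def by (intro sign_pair_prod pair) simp
  then show ?thesis using assms(2) by simp
qed

end

section \<open>Ring homomorphisms, to be applied to the relabelling of flags\<close>

locale comm_ring_map =
  fixes \<rho> :: "'a::comm_ring_1 \<Rightarrow> 'b::comm_ring_1"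
  assumes map_add: "\<rho> (x + y) = \<rho> x + \<rho> y"
    and map_mult: "\<rho> (x * y) = \<rho> x * \<rho> y"
    and map_1: "\<rho> 1 = 1"
begin

lemma map_0: "\<rho> 0 = 0"
  using map_add[of 0 0] by simp

lemma map_minus: "\<rho> (- x) = - \<rho> x"
  using map_add[of "- x" x] map_0 by (simp add: eq_neg_iff_add_eq_0)

lemma map_power: "\<rho> (x ^ r) = \<rho> x ^ r"
  by (induction r) (simp_all add: map_1 map_mult)

lemma map_sum: "\<rho> (\<Sum>i\<in>A. f i) = (\<Sum>i\<in>A. \<rho> (f i))"
  by (induction A rule: infinite_finite_induct) (simp_all add: map_0 map_add)

lemma map_prod: "\<rho> (\<Prod>i\<in>A. f i) = (\<Prod>i\<in>A. \<rho> (f i))"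
  by (induction A rule: infinite_finite_induct) (simp_all add: map_1 map_mult)

text \<open>The hypothesis excludes non-units, at which \<open>unit_inv\<close> is an unspecified
  value.\<close>

lemma map_unit_inv: "u * unit_inv u = 1 \<Longrightarrow> \<rho> (unit_inv u) = unit_inv (\<rho> u)"
  by (rule unit_inv_eq[symmetric]) (simp add: map_1 flip: map_mult)

end

section \<open>Graphs with involutions\<close>

lemma opp_eq: "ends G e = {v, w} \<Longrightarrow> opp G e v = w"
  unfolding opp_def by (rule the_equality) (auto simp: doubleton_eq_iff)

definition swap_sign :: "nat \<times> bool \<Rightarrow> nat \<times> bool" where
  "swap_sign x = (fst x, \<not> snd x)"

lemma fst_swap_sign [simp]: "fst (swap_sign x) = fst x"
  and swap_sign_swap_sign [simp]: "swap_sign (swap_sign x) = x"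
  by (simp_all add: swap_sign_def)

locale real_graph =
  fixes n l :: nat and G :: "('v, 'e) dgraph" and \<sigma> :: "('v \<Rightarrow> 'v) \<times> ('e \<Rightarrow> 'e)"
  assumes dgraph: "is_dgraph n l G"
    and involution: "is_involution n l G \<sigma>"
    and real_odd: "e \<in> real_edges G \<sigma> \<Longrightarrow> odd (edeg G e)"
    and lab_not_fixed: "v \<in> Ver G \<Longrightarrow> lab G v \<noteq> 2 * (n div 2) + 1"
begin

abbreviation sv :: "'v \<Rightarrow> 'v" where "sv \<equiv> fst \<sigma>"
abbreviation se :: "'e \<Rightarrow> 'e" where "se \<equiv> snd \<sigma>"

lemma finite_Ver: "finite (Ver G)" and finite_Edg: "finite (Edg G)"
  using dgraph by (auto simp: is_dgraph_def)

lemma edeg_pos: "e \<in> Edg G \<Longrightarrow> edeg G e > 0"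
  using dgraph by (auto simp: is_dgraph_def)

lemma lab_range: "v \<in> Ver G \<Longrightarrow> lab G v \<in> {1..n}"
  using dgraph unfolding is_dgraph_def by blast

lemma ends_in_Ver: "e \<in> Edg G \<Longrightarrow> v \<in> ends G e \<Longrightarrow> v \<in> Ver G"
  using dgraph unfolding is_dgraph_def by blast

lemma ends_opp:
  assumes "e \<in> Edg G" "v \<in> ends G e"
  shows "ends G e = {v, opp G e v}"
proof -
  from assms dgraph have "card (ends G e) = 2" by (simp add: is_dgraph_def)
  then obtain x y where "ends G e = {x, y}" by (auto simp: card_2_iff)
  with assms(2) obtain w where "ends G e = {v, w}" by auto
  with opp_eq[OF this] show ?thesis by simp
qed

lemma opp_in_ends: "e \<in> Edg G \<Longrightarrow> v \<in> ends G e \<Longrightarrow> opp G e v \<in> ends G e"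
  using ends_opp[of e v] by simp

lemma opp_in_Ver: "e \<in> Edg G \<Longrightarrow> v \<in> ends G e \<Longrightarrow> opp G e v \<in> Ver G"
  by (rule ends_in_Ver[OF _ opp_in_ends])

lemma lab_opp_neq: "e \<in> Edg G \<Longrightarrow> v \<in> ends G e \<Longrightarrow> lab G v \<noteq> lab G (opp G e v)"
  using dgraph by (auto simp: is_dgraph_def)

lemma opp_opp: "e \<in> Edg G \<Longrightarrow> v \<in> ends G e \<Longrightarrow> opp G e (opp G e v) = v"
  using ends_opp[of e v] by (intro opp_eq) (simp add: insert_commute)

lemma sv_in_Ver: "v \<in> Ver G \<Longrightarrow> sv v \<in> Ver G"
  using involution permutes_in_image[of sv "Ver G"]
  by (auto simp: is_involution_def graph_aut_def)

lemma se_in_Edg: "e \<in> Edg G \<Longrightarrow> se e \<in> Edg G"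
  using involution permutes_in_image[of se "Edg G"]
  by (auto simp: is_involution_def graph_aut_def)

lemma ends_se: "e \<in> Edg G \<Longrightarrow> ends G (se e) = sv ` ends G e"
  using involution by (auto simp: is_involution_def graph_aut_def)

lemma sv_sv: "v \<in> Ver G \<Longrightarrow> sv (sv v) = v"
  and genus_sv: "v \<in> Ver G \<Longrightarrow> genus G (sv v) = genus G v"
  and lab_sv: "v \<in> Ver G \<Longrightarrow> lab G (sv v) = phi n (lab G v)"
  and se_se: "e \<in> Edg G \<Longrightarrow> se (se e) = e"
  and edeg_se: "e \<in> Edg G \<Longrightarrow> edeg G (se e) = edeg G e"
  using involution by (auto simp: is_involution_def)

lemma mark_swap_sign: "x \<in> marks l \<Longrightarrow> mark G (swap_sign x) = sv (mark G x)"
  using involution by (cases x) (auto simp: is_involution_def swap_sign_def)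

lemma opp_se: "e \<in> Edg G \<Longrightarrow> v \<in> ends G e \<Longrightarrow> opp G (se e) (sv v) = sv (opp G e v)"
  using arg_cong[OF ends_opp[of e v], of "image sv"] by (intro opp_eq) (simp add: ends_se)

lemma psi_edge_sv:
  assumes "e \<in> Edg G" "v \<in> ends G e"
  shows "psi_edge n G (se e) (sv v) = - psi_edge n G e v"
proof -
  have "v \<in> Ver G" "opp G e v \<in> Ver G" using assms by (simp_all add: ends_in_Ver opp_in_Ver)
  then show ?thesis using assms
    by (simp add: psi_edge_def opp_se edeg_se lab_sv alpha_phi[OF lab_range] diff_divide_distrib)
qed

lemma psi_edge_neq_0: "e \<in> Edg G \<Longrightarrow> v \<in> ends G e \<Longrightarrow> psi_edge n G e v \<noteq> 0"
  using alpha_eq_iff[OF lab_range lab_range, of v "opp G e v"] lab_opp_neq[of e v] edeg_pos[of e]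
  by (auto simp: psi_edge_def ends_in_Ver opp_in_Ver)

lemma bij_betw_edges_at:
  assumes "v \<in> Ver G"
  shows "bij_betw se (edges_at G v) (edges_at G (sv v))"
proof (rule bij_betwI[where g = se])
  show "se \<in> edges_at G v \<rightarrow> edges_at G (sv v)"
    by (auto simp: edges_at_def se_in_Edg ends_se)
  show "se \<in> edges_at G (sv v) \<rightarrow> edges_at G v"
  proof
    fix e assume e: "e \<in> edges_at G (sv v)"
    then have "sv (sv v) \<in> ends G (se e)" by (auto simp: edges_at_def ends_se)
    then show "se e \<in> edges_at G v"
      using e assms by (simp add: edges_at_def se_in_Edg sv_sv)
  qed
qed (auto simp: edges_at_def se_se)

lemma bij_betw_marks_at:
  assumes "v \<in> Ver G"
  shows "bij_betw swap_sign (marks_at l G v) (marks_at l G (sv v))"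
proof (rule bij_betwI[where g = swap_sign])
  have swap: "swap_sign x \<in> marks l" if "x \<in> marks l" for x
    using that by (auto simp: marks_def swap_sign_def)
  then show "swap_sign \<in> marks_at l G v \<rightarrow> marks_at l G (sv v)"
    by (auto simp: marks_at_def mark_swap_sign)
  show "swap_sign \<in> marks_at l G (sv v) \<rightarrow> marks_at l G v"
    using assms swap by (auto simp: marks_at_def mark_swap_sign sv_sv)
qed auto

lemma finite_edges_at: "finite (edges_at G v)"
  using finite_Edg by (simp add: edges_at_def)

lemma finite_marks_at: "finite (marks_at l G v)"
  by (simp add: marks_at_def marks_def)

lemma finite_flags_at: "finite (flags_at l G v)"
  by (simp add: flags_at_def finite_edges_at finite_marks_at)

lemma card_flags_at: "card (flags_at l G v) = card (edges_at G v) + card (marks_at l G v)"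
  unfolding flags_at_def by (rule card_Plus[OF finite_edges_at finite_marks_at])

lemma bij_betw_flags_at:
  assumes "v \<in> Ver G"
  shows "bij_betw (map_sum se swap_sign) (flags_at l G v) (flags_at l G (sv v))"
proof -
  have "map_sum se swap_sign \<in> flags_at l G v \<rightarrow> flags_at l G (sv v)" if "v \<in> Ver G" for v
    using bij_betwE[OF bij_betw_edges_at[OF that]] bij_betwE[OF bij_betw_marks_at[OF that]]
    by (auto simp: flags_at_def)
  from this[OF assms] this[OF sv_in_Ver[OF assms]] show ?thesis
    by (intro bij_betwI[where g = "map_sum se swap_sign"])
      (auto simp: sv_sv[OF assms] flags_at_def edges_at_def se_se)
qed

lemma card_edges_at_sv: "v \<in> Ver G \<Longrightarrow> card (edges_at G (sv v)) = card (edges_at G v)"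
  using bij_betw_same_card[OF bij_betw_edges_at] by simp

lemma card_marks_at_sv: "v \<in> Ver G \<Longrightarrow> card (marks_at l G (sv v)) = card (marks_at l G v)"
  using bij_betw_same_card[OF bij_betw_marks_at] by simp

lemma valence_sv: "v \<in> Ver G \<Longrightarrow> valence l G (sv v) = valence l G v"
  by (simp add: valence_def genus_sv card_edges_at_sv card_marks_at_sv)

lemma mark_sum_sv: "v \<in> Ver G \<Longrightarrow> mark_sum b l G (sv v) = mark_sum b l G v"
  unfolding mark_sum_def
  by (subst sum.reindex_bij_betw[OF bij_betw_marks_at, symmetric]) simp_all

text \<open>The involution carries the plus marks at \<open>v\<close> to the minus marks at the
  image, so the two exponents together sum 1 + b + p over all marks at \<open>v\<close>. The genus
  and edge terms enter twice and disappear modulo 2.\<close>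

lemma sgn_exp_sv:
  assumes "v \<in> Ver G"
  shows "(- 1 :: ratfun) powi sgn_exp b p l G (sv v) =
    (- 1) ^ (card (marks_at l G v) + mark_sum b l G v + mark_sum p l G v) * (- 1) powi sgn_exp b
      p l G v"
proof -
  let ?w = "\<lambda>i. 1 + int (b i) + int (p i)"
  have split: "(\<Sum>x\<in>marks_at l G v. ?w (fst x)) =
      (\<Sum>i | (i, True) \<in> marks_at l G v. ?w i) + (\<Sum>i | (i, False) \<in> marks_at l G v. ?w i)"
  proof -
    have half: "(\<Sum>x\<in>{x \<in> marks_at l G v. snd x = s}. ?w (fst x)) =
        (\<Sum>i | (i, s) \<in> marks_at l G v. ?w i)" for s
      by (rule sum.reindex_bij_witness[where i = "\<lambda>i. (i, s)" and j = fst]) auto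
    have "(\<Sum>x\<in>marks_at l G v. ?w (fst x)) =
        (\<Sum>x\<in>{x \<in> marks_at l G v. snd x = True} \<union> {x \<in> marks_at l G v. snd x = False}. ?w (fst x))"
      by (rule sum.cong) auto
    also have "\<dots> = (\<Sum>x\<in>{x \<in> marks_at l G v. snd x = True}. ?w (fst x)) +
        (\<Sum>x\<in>{x \<in> marks_at l G v. snd x = False}. ?w (fst x))"
      by (rule sum.union_disjoint) (auto simp: finite_marks_at)
    finally show ?thesis unfolding half .
  qed
  have "(i, False) \<in> marks_at l G (sv v) \<longleftrightarrow> (i, True) \<in> marks_at l G v" for i
  proof -
    have "marks_at l G (sv v) = swap_sign ` marks_at l G v"
      using bij_betw_marks_at[OF assms] by (simp add: bij_betw_def)
    then have "(i, False) \<in> marks_at l G (sv v) \<longleftrightarrow> swap_sign (i, False) \<in> marks_at l G v"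
      by (metis image_iff swap_sign_swap_sign)
    then show ?thesis by (simp add: swap_sign_def)
  qed
  then have "sgn_exp b p l G (sv v) + sgn_exp b p l G v =
      2 * (int (genus G v) - 1 + int (card (edges_at G v))) + (\<Sum>x\<in>marks_at l G v. ?w (fst x))"
    using split by (simp add: sgn_exp_def genus_sv card_edges_at_sv assms)
  also have "(\<Sum>x\<in>marks_at l G v. ?w (fst x)) =
      int (card (marks_at l G v) + mark_sum b l G v + mark_sum p l G v)"
    by (simp add: mark_sum_def sum.distrib)
  finally have sum: "sgn_exp b p l G (sv v) + sgn_exp b p l G v =
      2 * (int (genus G v) - 1 + int (card (edges_at G v))) +
      int (card (marks_at l G v) + mark_sum b l G v + mark_sum p l G v)" .
  have parity: "x + y = 2 * z + w \<Longrightarrow> even x \<longleftrightarrow> even (y + w)" for x y z w :: int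
    by presburger
  have "even (sgn_exp b p l G (sv v)) \<longleftrightarrow>
      even (sgn_exp b p l G v + int (card (marks_at l G v) + mark_sum b l G v + mark_sum p l G v))"
    (is "even ?x \<longleftrightarrow> even (?y + int ?z)")
    using sum by (rule parity)
  then have "(- 1 :: ratfun) powi ?x = (- 1) powi (?y + int ?z)"
    unfolding minus_one_powi by simp
  then show ?thesis by (simp add: power_int_add mult.commute del: of_nat_add)
qed

text \<open>No vertex carries a label fixed by \<open>phi\<close>, so an involution that fixes an
  edge has to interchange its ends.\<close>

lemma real_edge_opp:
  assumes "e \<in> real_edges G \<sigma>" "v \<in> ends G e"
  shows "opp G e v = sv v"
proof -
  from assms have e: "e \<in> Edg G" "se e = e" by (auto simp: real_edges_def)
  then have "sv v \<in> ends G e" using ends_se[OF e(1)] assms(2) by auto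
  then have "sv v \<in> {v, opp G e v}" using ends_opp[OF e(1) assms(2)] by simp
  moreover have "sv v \<noteq> v"
    using phi_neq[OF lab_range lab_not_fixed, of v] ends_in_Ver[OF e(1) assms(2)] lab_sv[of v]
      by auto
  ultimately show ?thesis by auto
qed

end

section \<open>The vertex factor under the involution\<close>

context real_graph
begin

text \<open>All weights at the image vertex are negated. In the stable case the integral is compared
  in two moves: \<open>sign_pair\<close> negates the weights while the flags stay in place, and the
  map supplied by \<open>relabel\<close> then carries the class to the flags of the image. The
  resulting sign is that of \<open>sgn_exp_sv\<close>.\<close>

lemma Cntr_vertex_sv:
  fixes M :: "('e + nat \<times> bool, 'h::comm_ring_1) mbar"
  assumes "mbar_theory M" "n \<ge> 1" "even (n + k)" "k * genus G v = 0" "v \<in> Ver G"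
  shows "Cntr_vertex M n k a b p l G (sv v) =
    (- 1) ^ (card (marks_at l G v) + mark_sum b l G v + mark_sum p l G v) * Cntr_vertex M n k a
      b p l G v"
proof -
  interpret mbar_theory M by fact
  define g where "g = genus G v"
  define i where "i = lab G v"
  define E where "E = edges_at G v"
  define m where "m = marks_at l G v"
  define S where "S = flags_at l G v"
  define val where "val = valence l G v"
  define z where "z e = psi_edge n G e v" for e
  define P where "P = mark_sum p l G v"
  define B where "B = mark_sum b l G v"
  define A where "A = (of_nat (\<Prod>r=1..k. a r) :: ratfun)"
  let ?pre = "\<lambda>i. (euler_tangent n i / (A * alpha n i ^ k)) powi (int (card E) - 1) * alpha n i ^ P"
  have i: "i \<in> {1..n}" unfolding i_def by (rule lab_range) fact
  have finite: "finite E" "finite m" "finite S"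
    by (simp_all add: E_def m_def S_def finite_edges_at finite_marks_at finite_flags_at)
  have bijE: "bij_betw se E (edges_at G (sv v))"
    unfolding E_def by (rule bij_betw_edges_at) fact
  have bijm: "bij_betw swap_sign m (marks_at l G (sv v))"
    unfolding m_def by (rule bij_betw_marks_at) fact
  have bijS: "bij_betw (map_sum se swap_sign) S (flags_at l G (sv v))"
    unfolding S_def by (rule bij_betw_flags_at) fact
  have z_se: "psi_edge n G (se e) (sv v) = - z e" if "e \<in> E" for e
    using that unfolding z_def E_def edges_at_def by (intro psi_edge_sv) auto
  have z_neq_0: "z e \<noteq> 0" if "e \<in> E" for e
    using that unfolding z_def E_def edges_at_def by (intro psi_edge_neq_0) auto
  have cardS: "card S = card E + card m"
    by (simp add: S_def E_def m_def card_flags_at)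
  have val: "val = 2 * g + card E + card m"
    by (simp add: val_def valence_def g_def E_def m_def)
  \<comment> \<open>The base of the first power changes by (-1)^(n - 1 + k) = -1; the exponents
    \<open>card E - 1\<close> and \<open>P\<close> give the rest.\<close>
  have pre: "?pre (phi n i) = (- 1) ^ (card E + 1 + P) * ?pre i"
  proof -
    have "euler_tangent n (phi n i) / (A * alpha n (phi n i) ^ k) =
        (- 1) ^ (n - 1) * (- 1) ^ k * (euler_tangent n i / (A * alpha n i ^ k))"
      using i by (simp add: euler_tangent_phi alpha_phi power_minus[of "alpha n i"]
        minus_one_power_iff)
    also have "(- 1) ^ (n - 1) * (- 1 :: ratfun) ^ k = - 1"
      using assms(2,3) by (simp add: minus_one_power_iff flip: power_add)
    finally have base: "euler_tangent n (phi n i) / (A * alpha n (phi n i) ^ k) =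
        - (euler_tangent n i / (A * alpha n i ^ k))" by simp
    have sgn: "(- 1 :: ratfun) powi (int (card E) - 1) = (- 1) ^ (card E + 1)"
      by (simp add: minus_one_powi minus_one_power_iff)
    show ?thesis
      unfolding base
      unfolding minus_powi[of "euler_tangent n i / (A * alpha n i ^ k)"] sgn alpha_phi[OF i]
        power_minus[of "alpha n i"] power_add[of _ "card E + 1" P]
      by (simp only: ac_simps)
  qed
  note sv_simps = card_edges_at_sv[OF assms(5)] mark_sum_sv[OF assms(5)] valence_sv[OF assms(5)]
    genus_sv[OF assms(5)] lab_sv[OF assms(5)]
  show ?thesis
  proof (cases "val \<ge> 3")
    case True
    let ?S' = "flags_at l G (sv v)"
    have stable: "stable g S" using True val cardS finite by (simp add: stable_def)
    define U where "U z = (\<Prod>e\<in>E. scal M (z e) * (scal M (z e) + psi M g S (Inl e)))" for z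
    define Q where "Q = (\<Prod>x\<in>m. psi M g S (Inr x) ^ b (fst x))"
    define X where "X = euler_hodge M n g S i * unit_inv (U z) * Q"
    define Y where "Y = euler_hodge M n g S (phi n i) * unit_inv (U (\<lambda>e. - z e)) * Q"
    have sub: "Inl ` E \<subseteq> S" "Inr ` m \<subseteq> S" by (auto simp: E_def m_def S_def flags_at_def)
    have "sign_pair M ((n - 1) * g + 0 + (\<Sum>x\<in>m. 1 * b (fst x))) X Y"
      unfolding X_def Y_def
    proof (intro sign_pair_mult)
      show "sign_pair M ((n - 1) * g) (euler_hodge M n g S i) (euler_hodge M n g S (phi n i))"
        by (rule sign_pair_euler_hodge[OF stable i])
      show "sign_pair M 0 (unit_inv (U z)) (unit_inv (U (\<lambda>e. - z e)))"
        unfolding U_def using stable finite(1) sub(1) z_neq_0 by (rule unit_inv_psi_product(2))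
      show "sign_pair M (\<Sum>x\<in>m. 1 * b (fst x)) Q Q"
        unfolding Q_def by (intro sign_pair_prod sign_pair_power sign_pair_psi stable finite)
          (use sub in auto)
    qed
    from integ_sign_pair[OF stable this]
    have integ_Y: "integ M g S Y = (- 1) ^ ((n - 1) * g + 0 + (\<Sum>x\<in>m. 1 * b (fst x)) + g + card S
      + 1) * integ M g S X" .
    have "(- 1 :: ratfun) ^ (card E + 1 + P) * (- 1) ^ ((n - 1) * g + 0 + (\<Sum>x\<in>m. 1 * b (fst x))
      + g + card S + 1) =
        (- 1) ^ (card m + B + P)"
    proof -
      \<comment> \<open>If \<open>k = 0\<close> then \<open>n\<close> is even, and otherwise
        \<open>g = 0\<close>.\<close>
      have "even (n * g)"
        using assms(3,4) by (auto simp: g_def)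
      then have "even ((n - 1) * g + g)" using assms(2) by (simp add: diff_mult_distrib)
      then have "even (card E + 1 + P + (N + 0 + B + g + (card E + card m) + 1) + (card m + B + P))"
        if "N = (n - 1) * g" for N using that by presburger
      moreover have "(\<Sum>x\<in>m. 1 * b (fst x)) = B"
        by (simp add: B_def m_def mark_sum_def)
      ultimately show ?thesis
        unfolding power_add[symmetric] by (intro minus_one_power_cong) (simp only: cardS)
    qed
    note sign = this
    obtain \<rho> where \<rho>: "\<And>c c'. \<rho> (c + c') = \<rho> c + \<rho> c'" "\<And>c c'. \<rho> (c * c') = \<rho> c * \<rho> c'"
        "\<And>x. \<rho> (scal M x) = scal M x"
        "\<And>s. s \<in> S \<Longrightarrow> \<rho> (psi M g S s) = psi M g ?S' (map_sum se swap_sign s)"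
        "\<And>q. \<rho> (lam M g S q) = lam M g ?S' q"
        "\<And>c. integ M g ?S' (\<rho> c) = integ M g S c"
      using relabel[OF stable bijS] by metis
    interpret comm_ring_map \<rho>
      by unfold_locales (use \<rho>(1,2) \<rho>(3)[of 1] scal_1 in simp_all)
    have \<rho>_euler: "\<rho> (euler_hodge M n g S (phi n i)) = euler_hodge M n g ?S' (phi n i)"
      unfolding euler_hodge_def
      by (simp add: map_prod map_sum map_mult map_power map_minus map_1 \<rho>)
    have "\<rho> (U (\<lambda>e. - z e)) = (\<Prod>e\<in>E. scal M (psi_edge n G (se e) (sv v)) *
        (scal M (psi_edge n G (se e) (sv v)) + psi M g ?S' (Inl (se e))))"
      unfolding U_def map_prod using sub by (intro prod.cong refl) (auto simp: map_mult map_add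
        \<rho> z_se)
    also have "\<dots> = (\<Prod>e\<in>edges_at G (sv v). scal M (psi_edge n G e (sv v)) *
        (scal M (psi_edge n G e (sv v)) + psi M g ?S' (Inl e)))"
      by (rule prod.reindex_bij_betw[OF bijE])
    finally have \<rho>_U: "\<rho> (U (\<lambda>e. - z e)) = \<dots>" .
    have "U (\<lambda>e. - z e) * unit_inv (U (\<lambda>e. - z e)) = 1"
      unfolding U_def using stable finite(1) sub(1) by (rule unit_inv_psi_product(1)) (simp add:
        z_neq_0)
    note \<rho>_inv = map_unit_inv[OF this]
    have "\<rho> Q = (\<Prod>x\<in>m. psi M g ?S' (Inr (swap_sign x)) ^ b (fst (swap_sign x)))"
      unfolding Q_def map_prod using sub by (intro prod.cong refl) (auto simp: map_power \<rho>)
    also have "\<dots> = (\<Prod>x\<in>marks_at l G (sv v). psi M g ?S' (Inr x) ^ b (fst x))"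
      by (rule prod.reindex_bij_betw[OF bijm])
    finally have \<rho>_Q: "\<rho> Q = \<dots>" .
    have "Cntr_vertex M n k a b p l G (sv v) = ?pre (phi n i) * integ M g ?S' (\<rho> Y)"
      unfolding Y_def map_mult \<rho>_euler \<rho>_inv \<rho>_U \<rho>_Q Cntr_vertex_def Let_def sv_simps
      using True by (simp only: g_def i_def val_def E_def P_def A_def if_True)
    also have "\<dots> = ?pre (phi n i) * integ M g S Y" by (simp only: \<rho>)
    also have "\<dots> = ((- 1) ^ (card E + 1 + P) * (- 1) ^ ((n - 1) * g + 0 + (\<Sum>x\<in>m. 1 * b (fst x))
      + g + card S + 1))
        * (?pre i * integ M g S X)"
      unfolding pre integ_Y by (simp only: ac_simps)
    also have "?pre i * integ M g S X = Cntr_vertex M n k a b p l G v"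
      unfolding X_def U_def Q_def Cntr_vertex_def Let_def
      using True by (simp only: g_def i_def val_def E_def S_def m_def P_def A_def z_def if_True)
    finally have "Cntr_vertex M n k a b p l G (sv v) =
        (- 1) ^ (card m + B + P) * Cntr_vertex M n k a b p l G v"
      unfolding sign .
    then show ?thesis unfolding B_def P_def m_def .
  next
    case False
    let ?r = "3 - int val - int (card E) + int B"
    let ?inv = "\<lambda>z E. inverse (\<Prod>e\<in>E. z e :: ratfun)"
    have "(\<Prod>e\<in>edges_at G (sv v). psi_edge n G e (sv v)) = (\<Prod>e\<in>E. psi_edge n G (se e) (sv v))"
      by (rule prod.reindex_bij_betw[OF bijE, symmetric])
    also have "\<dots> = (\<Prod>e\<in>E. - z e)" by (intro prod.cong refl z_se)
    also have "\<dots> = (- 1) ^ card E * (\<Prod>e\<in>E. z e)" by (rule prod_uminus)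
    finally have prod: "(\<Prod>e\<in>edges_at G (sv v). psi_edge n G e (sv v)) = \<dots>" .
    have "(\<Sum>e\<in>edges_at G (sv v). psi_edge n G e (sv v)) = (\<Sum>e\<in>E. psi_edge n G (se e) (sv v))"
      by (rule sum.reindex_bij_betw[OF bijE, symmetric])
    also have "\<dots> = (\<Sum>e\<in>E. - z e)" by (intro sum.cong refl z_se)
    also have "\<dots> = - (\<Sum>e\<in>E. z e)" by (rule sum_negf)
    finally have sum: "(\<Sum>e\<in>edges_at G (sv v). psi_edge n G e (sv v)) = \<dots>" .
    have sgn: "(- 1 :: ratfun) powi ?r = (- 1) ^ (1 + val + card E + B)"
      by (auto simp: minus_one_powi minus_one_power_iff)
    \<comment> \<open>Modulo 2 the exponents add up to \<open>val + card E + B + P\<close>, and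
      \<open>val\<close> is congruent to \<open>card E + card m\<close>.\<close>
    have sign: "(- 1 :: ratfun) ^ (card E + 1 + P) * (- 1) ^ card E * (- 1) ^ (1 + val + card E
      + B) =
        (- 1) ^ (card m + B + P)"
      unfolding power_add[symmetric] by (intro minus_one_power_cong) (simp add: val)
    have inverse_sign: "inverse ((- 1) ^ r * x) = (- 1) ^ r * inverse x" for r and x :: ratfun
      by (simp add: power_inverse[symmetric])
    have "Cntr_vertex M n k a b p l G (sv v) = - ((- 1) ^ val) * ?pre (phi n i) *
        inverse ((- 1) ^ card E * (\<Prod>e\<in>E. z e)) * (- (\<Sum>e\<in>E. z e)) powi ?r"
      unfolding prod[symmetric] sum[symmetric] Cntr_vertex_def Let_def sv_simps
      using False by (simp only: g_def i_def val_def E_def P_def B_def A_def if_False)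
    also have "\<dots> = (- 1) ^ (card E + 1 + P) * (- 1) ^ card E * (- 1) ^ (1 + val + card E + B) *
        (- ((- 1) ^ val) * ?pre i * inverse (\<Prod>e\<in>E. z e) * (\<Sum>e\<in>E. z e) powi ?r)"
      unfolding pre inverse_sign minus_powi[of "\<Sum>e\<in>E. z e"] sgn by (simp only: ac_simps)
    also have "- ((- 1) ^ val) * ?pre i * inverse (\<Prod>e\<in>E. z e) * (\<Sum>e\<in>E. z e) powi ?r =
        Cntr_vertex M n k a b p l G v"
      unfolding Cntr_vertex_def Let_def
      using False by (simp only: g_def i_def val_def E_def P_def B_def A_def z_def if_False)
    finally have "Cntr_vertex M n k a b p l G (sv v) =
        (- 1) ^ (card m + B + P) * Cntr_vertex M n k a b p l G v"
      unfolding sign .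
    then show ?thesis unfolding B_def P_def m_def .
  qed
qed

end

section \<open>Edge factors\<close>

text \<open>No involution enters here, so the factor can also be evaluated on edges that are real
  for the first involution and complex for the second.\<close>

definition complex_factor :: "nat \<Rightarrow> nat \<Rightarrow> (nat \<Rightarrow> nat) \<Rightarrow> nat \<Rightarrow> nat \<Rightarrow> nat \<Rightarrow> ratfun" where
  "complex_factor n k a t i i' =
     (if odd n \<and> even t \<and> i = phi n i' then Cntr_edge_special n k a t i i'
      else Cntr_edge_complex n k a t i i')"

lemma power_minus_even': "(- x :: 'a::ring_1) ^ (2 * r - 2) = x ^ (2 * r - 2)"
  by simp

text \<open>Reversing the index \<open>r\<close> exchanges the ends, and the difference of the
  weights occurs to the even power \<open>2 * t - 2\<close>.\<close>

lemma Cntr_edge_complex_commute: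
  "Cntr_edge_complex n k a t i' i = Cntr_edge_complex n k a t i i'"
proof -
  have flip: "(\<Prod>r=0..N. f (N - r) r) = (\<Prod>r=0..N. f r (N - r))" for N and f :: "nat \<Rightarrow> nat \<Rightarrow> ratfun"
    by (subst prod.atLeastAtMost_rev) (auto intro!: prod.cong)
  have num: "(\<Prod>r=0..N. (of_nat (N - r) * alpha n i' + of_nat r * alpha n i) / of_nat t) =
      (\<Prod>r=0..N. (of_nat (N - r) * alpha n i + of_nat r * alpha n i') / of_nat t)" for N
    using flip[of "\<lambda>x y. (of_nat x * alpha n i' + of_nat y * alpha n i) / of_nat t" N]
    by (simp add: add.commute)
  have den: "(\<Prod>r=0..N. (of_nat (N - r) * alpha n i' + of_nat r * alpha n i) / of_nat t - c) =
      (\<Prod>r=0..N. (of_nat (N - r) * alpha n i + of_nat r * alpha n i') / of_nat t - c)" for N c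
    using flip[of "\<lambda>x y. (of_nat x * alpha n i' + of_nat y * alpha n i) / of_nat t - c" N]
    by (simp add: add.commute)
  have "(alpha n i' - alpha n i) / of_nat t = - ((alpha n i - alpha n i') / of_nat t)"
    by (simp add: diff_divide_distrib)
  then have pow: "((alpha n i' - alpha n i) / of_nat t) ^ (2 * t - 2) =
      ((alpha n i - alpha n i') / of_nat t) ^ (2 * t - 2)"
    by (simp only: power_minus_even')
  show ?thesis
    unfolding Cntr_edge_complex_def num den pow by (simp only: insert_commute)
qed

text \<open>For odd degrees the numerator changes by (-1)^((t + 1) k) and the denominator by
  (-1)^((t + 1) (n - 2)); these agree because n + k is even.\<close>

lemma Cntr_edge_complex_phi:
  assumes "i \<in> {1..n}" "i' \<in> {1..n}" "i \<noteq> i'" "even (n + k)" "\<And>c. c \<in> {1..k} \<Longrightarrow> odd (a c)"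
  shows "Cntr_edge_complex n k a t (phi n i) (phi n i') = Cntr_edge_complex n k a t i i'"
proof -
  let ?x = "\<lambda>N r. (of_nat (N - r) * alpha n i + of_nat r * alpha n i') / of_nat t"
  have x: "(of_nat (N - r) * alpha n (phi n i) + of_nat r * alpha n (phi n i')) / of_nat t = -
    ?x N r" for N r
    using assms(1,2) by (simp add: alpha_phi diff_divide_distrib add_divide_distrib)
  have "(\<Prod>c=1..k. \<Prod>r=0..a c * t. - ?x (a c * t) r) =
      (\<Prod>c=1..k. (- 1) ^ (a c * t + 1) * (\<Prod>r=0..a c * t. ?x (a c * t) r))"
    by (intro prod.cong refl) (simp only: prod_uminus card_atLeastAtMost, simp)
  also have "\<dots> = (\<Prod>c=1..k. (- 1) ^ (t + 1) * (\<Prod>r=0..a c * t. ?x (a c * t) r))"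
    using assms(5) by (intro prod.cong refl arg_cong2[where f = "(*)"] minus_one_power_cong) simp
  also have "\<dots> = (- 1) ^ ((t + 1) * k) * (\<Prod>c=1..k. \<Prod>r=0..a c * t. ?x (a c * t) r)"
    unfolding prod.distrib by (simp only: power_mult prod_constant card_atLeastAtMost diff_Suc_1)
  finally have num: "(\<Prod>c=1..k. \<Prod>r=0..a c * t. - ?x (a c * t) r) = \<dots>" .
  have card: "card ({1..n} - {i, i'}) = n - 2"
    using assms(1-3) by (simp add: card_Diff_subset)
  have "(\<Prod>j\<in>{1..n} - {phi n i, phi n i'}. \<Prod>r=0..t. - ?x t r - alpha n j) =
      (\<Prod>j\<in>{1..n} - {i, i'}. \<Prod>r=0..t. - ?x t r - alpha n (phi n j))"
    using assms by (intro prod.reindex_bij_betw[symmetric]) (use bij_betw_phi_diff[of "{i, i'}"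
      n] in simp)
  also have "\<dots> = (\<Prod>j\<in>{1..n} - {i, i'}. \<Prod>r=0..t. - (?x t r - alpha n j))"
    by (intro prod.cong refl) (simp add: alpha_phi)
  also have "\<dots> = (\<Prod>j\<in>{1..n} - {i, i'}. (- 1) ^ (t + 1) * (\<Prod>r=0..t. ?x t r - alpha n j))"
    by (intro prod.cong refl) (simp only: prod_uminus card_atLeastAtMost, simp)
  also have "\<dots> = (- 1) ^ ((t + 1) * (n - 2)) * (\<Prod>j\<in>{1..n} - {i, i'}. \<Prod>r=0..t. ?x t r - alpha n j)"
    unfolding prod.distrib by (simp only: power_mult prod_constant card)
  finally have den: "(\<Prod>j\<in>{1..n} - {phi n i, phi n i'}. \<Prod>r=0..t. - ?x t r - alpha n j) = \<dots>" .
  have pow: "((alpha n (phi n i) - alpha n (phi n i')) / of_nat t) ^ (2 * t - 2) =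
      ((alpha n i - alpha n i') / of_nat t) ^ (2 * t - 2)"
  proof -
    have "(alpha n (phi n i) - alpha n (phi n i')) / of_nat t = - ((alpha n i - alpha n i') /
      of_nat t)"
      using assms(1,2) by (simp add: alpha_phi diff_divide_distrib)
    then show ?thesis by (simp only: power_minus_even')
  qed
  have "n \<ge> 2" using assms(1-3) by auto
  then have "even ((t + 1) * k + (t + 1) * (n - 2))"
    using assms(4) by (simp flip: distrib_left)
  then have sgn: "(- 1 :: ratfun) ^ ((t + 1) * k) = (- 1) ^ ((t + 1) * (n - 2))"
    by (rule minus_one_power_cong)
  show ?thesis
    unfolding Cntr_edge_complex_def x num den pow sgn by simp
qed

text \<open>Reversal negates the weight, which occurs only in a power with even exponent and in
  squares.\<close>

lemma Cntr_edge_special_commute: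
  assumes "even t" "i' \<in> {1..n}"
  shows "Cntr_edge_special n k a t i' (phi n i') = Cntr_edge_special n k a t (phi n i') i'"
proof -
  let ?x = "2 * alpha n i' / of_nat t" and ?z = "(int (a 1) - 3) * int t + 2"
  have x: "2 * alpha n (phi n i') / of_nat t = - ?x" using assms(2) by (simp add: alpha_phi)
  have "even ?z" using assms(1) by simp
  then have pow: "(- ?x) powi ?z = ?x powi ?z"
    by (simp only: minus_powi[of ?x] minus_one_powi if_True mult_1)
  show ?thesis
    unfolding Cntr_edge_special_def x pow by (simp only: insert_commute power2_minus)
qed

lemma complex_factor_commute:
  assumes "i \<in> {1..n}" "i' \<in> {1..n}"
  shows "complex_factor n k a t i' i = complex_factor n k a t i i'"
proof (cases "odd n \<and> even t \<and> i = phi n i'")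
  case True
  then have i: "i = phi n i'" "i' = phi n i" using phi_phi[OF assms(2)] by simp_all
  have "complex_factor n k a t i' i = Cntr_edge_special n k a t i' i"
    "complex_factor n k a t i i' = Cntr_edge_special n k a t i i'"
    unfolding complex_factor_def using True i(2) by (simp_all only: if_True simp_thms)
  then show ?thesis
    using True Cntr_edge_special_commute[of t i' n k a] assms(2) by (simp only:)
next
  case False
  then have "\<not> (odd n \<and> even t \<and> i' = phi n i)" using phi_phi[OF assms(1)] by auto
  with False show ?thesis
    unfolding complex_factor_def Cntr_edge_complex_commute[of n k a t i'] by (simp only: if_False)
qed

lemma complex_factor_phi:
  assumes "i \<in> {1..n}" "i' \<in> {1..n}" "i \<noteq> i'" "even (n + k)" "\<And>c. c \<in> {1..k} \<Longrightarrow> odd (a c)"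
  shows "complex_factor n k a t (phi n i) (phi n i') = complex_factor n k a t i i'"
proof (cases "odd n \<and> even t \<and> i = phi n i'")
  case True
  \<comment> \<open>Here \<open>phi\<close> merely exchanges the two labels, so invariance is the
    commutation lemma.\<close>
  then have "phi n i = i'" "phi n i' = i" using phi_phi[OF assms(2)] by simp_all
  then show ?thesis using complex_factor_commute[OF assms(1,2)] by (simp only:)
next
  case False
  then have "\<not> (odd n \<and> even t \<and> phi n i = phi n (phi n i'))"
    using phi_phi[OF assms(1)] phi_phi[OF assms(2)] by auto
  with False show ?thesis
    unfolding complex_factor_def using Cntr_edge_complex_phi[OF assms] by (simp only: if_False)
qed

section \<open>The factor of a real edge times that of its reversal\<close>

lemma prod_odd_half_split:
  fixes f :: "nat \<Rightarrow> 'a::comm_monoid_mult"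
  shows "(\<Prod>r=0..2 * q + 1. f r) = (\<Prod>r=0..q. f r) * (\<Prod>r=0..q. f (2 * q + 1 - r))"
proof -
  have "(\<Prod>r=0..2 * q + 1. f r) = (\<Prod>r\<in>{0..q} \<union> {q + 1..2 * q + 1}. f r)"
    by (rule prod.cong) auto
  also have "\<dots> = (\<Prod>r=0..q. f r) * (\<Prod>r=q + 1..2 * q + 1. f r)"
    by (rule prod.union_disjoint) auto
  also have "(\<Prod>r=q + 1..2 * q + 1. f r) = (\<Prod>r=0..q. f (2 * q + 1 - r))"
    by (rule prod.reindex_bij_witness[where i = "\<lambda>r. 2 * q + 1 - r" and j = "\<lambda>r. 2 * q + 1 -
      r"]) auto
  finally show ?thesis .
qed

lemma prod_eq_dfact: "(\<Prod>r=0..q. 2 * q + 1 - 2 * r) = dfact (2 * q + 1)"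
proof (induction q)
  case (Suc q)
  have "(\<Prod>r=0..Suc q. 2 * Suc q + 1 - 2 * r) =
      (2 * Suc q + 1) * (\<Prod>r=0..q. 2 * Suc q + 1 - 2 * Suc r)"
    unfolding atLeast0AtMost prod.atMost_Suc_shift by simp
  also have "(\<Prod>r=0..q. 2 * Suc q + 1 - 2 * Suc r) = dfact (2 * q + 1)"
    unfolding Suc.IH[symmetric] by simp
  finally show ?case by (simp add: algebra_simps)
qed simp

text \<open>The r-th term is (N - 2r) x/t, so the terms \<open>r\<close> and \<open>N - r\<close>
  are opposite: each half gives a double factorial, and the upper one also gives q + 1
  signs.\<close>

lemma prod_arithmetic_opposite:
  assumes "N = 2 * q + 1"
  shows "(\<Prod>r=0..N. (of_nat (N - r) * x + of_nat r * (- x)) / t :: ratfun) =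
    of_nat (dfact N) ^ 2 * (- 1) ^ (q + 1) * (x / t) ^ (2 * (q + 1))"
proof -
  have lower: "(of_nat (N - r) * x + of_nat r * (- x)) / t = of_nat (N - 2 * r) * (x / t)" if "r
    \<le> q" for r
    using that assms by (simp add: of_nat_diff algebra_simps add_divide_distrib diff_divide_distrib)
  have upper: "(of_nat (N - (N - r)) * x + of_nat (N - r) * (- x)) / t = - (of_nat (N - 2 * r) *
    (x / t))"
    if "r \<le> q" for r
    using that assms by (simp add: of_nat_diff algebra_simps add_divide_distrib diff_divide_distrib)
  have dfact: "(\<Prod>r=0..q. of_nat (N - 2 * r)) = (of_nat (dfact N) :: ratfun)"
    by (simp only: assms prod_eq_dfact of_nat_prod[symmetric])
  have "(\<Prod>r=0..N. (of_nat (N - r) * x + of_nat r * (- x)) / t) =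
      (\<Prod>r=0..q. of_nat (N - 2 * r) * (x / t)) * (\<Prod>r=0..q. - (of_nat (N - 2 * r) * (x / t)))"
    unfolding prod_odd_half_split[of "\<lambda>r. (of_nat (N - r) * x + of_nat r * (- x)) / t" q, folded
      assms]
    by (intro arg_cong2[where f = "(*)"] prod.cong refl lower upper) simp_all
  also have "(\<Prod>r=0..q. of_nat (N - 2 * r) * (x / t)) = of_nat (dfact N) * (x / t) ^ (q + 1)"
    unfolding prod.distrib dfact by simp
  also have "(\<Prod>r=0..q. - (of_nat (N - 2 * r) * (x / t))) = (- 1) ^ (q + 1) * (of_nat (dfact N) *
    (x / t) ^ (q + 1))"
    unfolding prod_uminus unfolding prod.distrib dfact by simp
  finally show ?thesis
    unfolding power2_eq_square mult_2 power_add[of "x / t" "q + 1" "q + 1"] by (simp only: ac_simps)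
qed

text \<open>The numerical data of a real edge of degree \<open>t\<close> with an end labelled
  \<open>i\<close>; its other end has label \<open>phi n i\<close> and the opposite weight.\<close>

locale opposite_weights =
  fixes n k :: nat and a :: "nat \<Rightarrow> nat" and t q i :: nat
  assumes t_eq: "t = 2 * q + 1"
    and i_range: "i \<in> {1..n}"
    and i_not_fixed: "i \<noteq> 2 * (n div 2) + 1"
    and odd_a: "\<And>c. c \<in> {1..k} \<Longrightarrow> odd (a c)"
begin

text \<open>Half the number of linear factors in the numerator of the complex factor.\<close>

abbreviation h :: nat where "h \<equiv> ((\<Sum>c=1..k. a c) * t + k) div 2"

text \<open>The denominator of the real factor as a function of the weight. Its values at the two
  opposite weights are the two halves of the denominator of the complex factor.\<close>

definition den :: "ratfun \<Rightarrow> ratfun" where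
  "den x = (\<Prod>j\<in>{1..n} - {i, phi n i}. \<Prod>r=0..q. of_int (int t - 2 * int r) * x / of_nat t - alpha
    n j)"

lemma card_labels: "card ({1..n} - {i, phi n i}) = n - 2" "n \<ge> 2"
  using phi_neq[OF i_range i_not_fixed] phi_range[OF i_range] i_range by (auto simp:
    card_Diff_subset)

lemma den_minus: "den (- alpha n i) = (- 1) ^ (n * (q + 1)) * den (alpha n i)"
proof -
  let ?x = "\<lambda>r. of_int (int t - 2 * int r) * alpha n i / of_nat t"
  have "phi n ` {i, phi n i} = {i, phi n i}"
    using phi_phi[OF i_range] by auto
  then have bij: "bij_betw (phi n) ({1..n} - {i, phi n i}) ({1..n} - {i, phi n i})"
    using bij_betw_phi_diff[of "{i, phi n i}" n] i_range phi_range[OF i_range] by simp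
  have "den (- alpha n i) = (\<Prod>j\<in>{1..n} - {i, phi n i}. \<Prod>r=0..q. - ?x r - alpha n j)"
    by (simp add: den_def)
  also have "\<dots> = (\<Prod>j\<in>{1..n} - {i, phi n i}. \<Prod>r=0..q. - ?x r - alpha n (phi n j))"
    by (rule prod.reindex_bij_betw[OF bij, symmetric])
  also have "\<dots> = (\<Prod>j\<in>{1..n} - {i, phi n i}. \<Prod>r=0..q. - (?x r - alpha n j))"
    by (intro prod.cong refl) (simp add: alpha_phi)
  also have "\<dots> = (\<Prod>j\<in>{1..n} - {i, phi n i}. (- 1) ^ (q + 1) * (\<Prod>r=0..q. ?x r - alpha n j))"
    by (intro prod.cong refl) (simp only: prod_uminus card_atLeastAtMost, simp)
  also have "\<dots> = (- 1) ^ ((q + 1) * (n - 2)) * den (alpha n i)"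
    unfolding prod.distrib den_def by (simp only: prod_constant card_labels(1) power_mult)
  also have "(- 1 :: ratfun) ^ ((q + 1) * (n - 2)) = (- 1) ^ (n * (q + 1))"
    using card_labels(2) by (intro minus_one_power_cong) (simp add: mult.commute[of n] flip:
      distrib_left)
  finally show ?thesis .
qed

lemma two_h: "2 * h = (\<Sum>c=1..k. a c * t + 1)"
proof -
  have "even (\<Sum>c=1..k. a c * t + 1)"
    by (rule dvd_sum) (use odd_a t_eq in auto)
  moreover have "(\<Sum>c=1..k. a c * t + 1) = (\<Sum>c=1..k. a c) * t + k"
    unfolding sum.distrib sum_distrib_right by simp
  ultimately show ?thesis by (metis dvd_mult_div_cancel)
qed

lemma sum_half_exponents: "(\<Sum>c=1..k. (a c * t + 1) div 2) = h"
proof -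
  have "2 * (\<Sum>c=1..k. (a c * t + 1) div 2) = (\<Sum>c=1..k. a c * t + 1)"
    unfolding sum_distrib_left by (intro sum.cong refl) (use odd_a t_eq in auto)
  with two_h show ?thesis by linarith
qed

lemma real_exponent: "(((\<Sum>c=1..k. int (a c)) - 2) * int t + int k) div 2 + 1 = int h - int t + 1"
proof -
  have "2 * int h = int (\<Sum>c=1..k. a c * t + 1)" by (simp only: two_h[symmetric])
  also have "int (\<Sum>c=1..k. a c * t + 1) = (\<Sum>c=1..k. int (a c)) * int t + int k"
    by (simp add: sum.distrib sum_distrib_right)
  finally have "((\<Sum>c=1..k. int (a c)) - 2) * int t + int k = 2 * (int h - int t)"
    unfolding left_diff_distrib right_diff_distrib by linarith
  then show ?thesis by (simp only: nonzero_mult_div_cancel_left)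
qed

lemma real_sign: "(- 1 :: ratfun) powi (int h - int t + 1) = (- 1) ^ h"
  by (simp add: minus_one_powi minus_one_power_iff t_eq)

lemma Cntr_edge_real_eq:
  "Cntr_edge_real \<phi> n k a t i (phi n i) = (- 1) ^ (inv_sgn \<phi> + q) / of_nat t
     * (of_nat (\<Prod>c=1..k. dfact (a c * t)) / of_nat (2 ^ (t - 1) * fact t))
     * ((alpha n i / of_nat t) powi (int h - int t + 1) / den (alpha n i))"
proof -
  have "(t - 1) div 2 = q" by (simp add: t_eq)
  then show ?thesis unfolding Cntr_edge_real_def den_def real_exponent by simp
qed

lemma Cntr_edge_real_commute:
  "Cntr_edge_real \<phi> n k a t (phi n i) i =
     (- 1) ^ (h + n * (q + 1)) * Cntr_edge_real \<phi> n k a t i (phi n i)"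
proof -
  have q: "(t - 1) div 2 = q" by (simp add: t_eq)
  have "Cntr_edge_real \<phi> n k a t (phi n i) i = (- 1) ^ (inv_sgn \<phi> + q) / of_nat t
     * (of_nat (\<Prod>c=1..k. dfact (a c * t)) / of_nat (2 ^ (t - 1) * fact t))
     * ((- (alpha n i / of_nat t)) powi (int h - int t + 1) / den (- alpha n i))"
    unfolding Cntr_edge_real_def den_def real_exponent q alpha_phi[OF i_range]
    by (simp add: insert_commute)
  also have "(- (alpha n i / of_nat t)) powi (int h - int t + 1) / den (- alpha n i) =
      (- 1) ^ (h + n * (q + 1)) * ((alpha n i / of_nat t) powi (int h - int t + 1) / den (alpha
        n i))"
    unfolding minus_powi[of "alpha n i / of_nat t"] real_sign den_minus power_add
    by (simp add: minus_one_power_iff)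
  finally show ?thesis unfolding Cntr_edge_real_eq by (simp only: ac_simps)
qed

lemma Cntr_edge_complex_eq:
  "Cntr_edge_complex n k a t i (phi n i) = - 1 / of_nat (t * (fact t)\<^sup>2)
     * ((of_nat (\<Prod>c=1..k. dfact (a c * t)) ^ 2 * (- 1) ^ h * (alpha n i / of_nat t) ^ (2 * h))
        / ((2 * (alpha n i / of_nat t)) ^ (2 * t - 2) * (den (alpha n i) * den (- alpha n i))))"
proof -
  let ?y = "alpha n i / of_nat t"
  have "(\<Prod>c=1..k. \<Prod>r=0..a c * t. (of_nat (a c * t - r) * alpha n i + of_nat r * (- alpha n i)) /
    of_nat t) =
      (\<Prod>c=1..k. of_nat (dfact (a c * t)) ^ 2 * (- 1) ^ ((a c * t + 1) div 2) * ?y ^ (2 * ((a c *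
        t + 1) div 2)))"
  proof (intro prod.cong refl)
    fix c assume "c \<in> {1..k}"
    then have "odd (a c * t)" using odd_a t_eq by simp
    then obtain u where u: "a c * t = 2 * u + 1" by (elim oddE)
    then have "(a c * t + 1) div 2 = u + 1" by simp
    then show "(\<Prod>r=0..a c * t. (of_nat (a c * t - r) * alpha n i + of_nat r * (- alpha n i)) /
      of_nat t) =
        of_nat (dfact (a c * t)) ^ 2 * (- 1) ^ ((a c * t + 1) div 2) * ?y ^ (2 * ((a c * t + 1)
          div 2))"
      using prod_arithmetic_opposite[OF u] by (simp only:)
  qed
  also have "\<dots> = of_nat (\<Prod>c=1..k. dfact (a c * t)) ^ 2 * (- 1) ^ h * ?y ^ (2 * h)"
    unfolding prod.distrib
    by (simp only: power_sum[symmetric] sum_distrib_left[symmetric] sum_half_exponents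
      of_nat_prod prod_power_distrib)
  finally have num: "(\<Prod>c=1..k. \<Prod>r=0..a c * t. (of_nat (a c * t - r) * alpha n i + of_nat r * (-
    alpha n i)) / of_nat t) = \<dots>" .
  have split: "(\<Prod>r=0..t. (of_nat (t - r) * alpha n i + of_nat r * (- alpha n i)) / of_nat t - z) =
      (\<Prod>r=0..q. of_int (int t - 2 * int r) * alpha n i / of_nat t - z) *
      (\<Prod>r=0..q. of_int (int t - 2 * int r) * (- alpha n i) / of_nat t - z)" for z
  proof -
    have "(of_nat (t - r) * alpha n i + of_nat r * (- alpha n i)) = of_int (int t - 2 * int r) *
      alpha n i"
      "(of_nat (t - (t - r)) * alpha n i + of_nat (t - r) * (- alpha n i)) = of_int (int t - 2 *
        int r) * (- alpha n i)"
      if "r \<le> q" for r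
      using that t_eq by (simp_all add: of_nat_diff algebra_simps)
    then show ?thesis
      unfolding prod_odd_half_split[of "\<lambda>r. (of_nat (t - r) * alpha n i + of_nat r * (- alpha n
        i)) / of_nat t - z" q, folded t_eq]
      by (intro arg_cong2[where f = "(*)"] prod.cong refl) (simp_all only: atLeastAtMost_iff)
  qed
  have "(\<Prod>j\<in>{1..n} - {i, phi n i}. \<Prod>r=0..t. (of_nat (t - r) * alpha n i + of_nat r * (- alpha n
    i)) / of_nat t - alpha n j) =
      den (alpha n i) * den (- alpha n i)"
    unfolding split prod.distrib den_def ..
  note den = this
  have "(alpha n i - - alpha n i) / of_nat t = 2 * ?y" by simp
  moreover have "(- 1 :: ratfun) ^ t = - 1" by (simp add: t_eq)
  ultimately show ?thesis
    unfolding Cntr_edge_complex_def alpha_phi[OF i_range] num den by (simp only:)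
qed

text \<open>The sign with exponent \<open>inv_sgn \<phi> + q\<close> is squared away, so the type of
  the involution disappears. The minus sign is (-1)^t from the complex factor, and the powers of 2
  match because the weight difference there is twice the weight.\<close>

lemma real_factors_mult:
  "of_nat t * Cntr_edge_real \<phi> n k a t i (phi n i) * Cntr_edge_real \<phi> n k a t (phi n i) i =
     - Cntr_edge_complex n k a t i (phi n i)"
proof -
  let ?y = "alpha n i / of_nat t" and ?w = "den (alpha n i)" and ?f = "of_nat (\<Prod>c=1..k. dfact (a
    c * t)) :: ratfun"
    and ?F = "of_nat (fact t) :: ratfun"
  have t: "of_nat t \<noteq> (0 :: ratfun)" by (simp only: of_nat_ratfun_eq_0_iff t_eq)
  then have y: "?y \<noteq> 0" using alpha_neq_0[OF i_range i_not_fixed] by simp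
  have "?y powi (int h - int t + 1) * ?y powi (int h - int t + 1) = ?y powi (int (2 * h) - int
    (2 * t - 2))"
    using y t_eq by (simp flip: power_int_add)
  also have "\<dots> = ?y ^ (2 * h) / ?y ^ (2 * t - 2)"
    by (simp only: power_int_diff[OF disjI1[OF y]] power_int_of_nat)
  finally have y_square: "?y powi (int h - int t + 1) * ?y powi (int h - int t + 1) = ?y ^ (2 *
    h) / ?y ^ (2 * t - 2)" .
  have two: "(2 :: ratfun) ^ (t - 1) * 2 ^ (t - 1) = 2 ^ (2 * t - 2)"
    by (simp flip: power_add mult_2 add: diff_mult_distrib2)
  have sgn: "(- 1 :: ratfun) ^ (inv_sgn \<phi> + q) * (- 1) ^ (inv_sgn \<phi> + q) = 1"
    by (simp flip: power_mult_distrib)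
  have "of_nat t * Cntr_edge_real \<phi> n k a t i (phi n i) * Cntr_edge_real \<phi> n k a t (phi n i) i =
      (- 1) ^ (h + n * (q + 1)) * (of_nat t / (of_nat t * of_nat t)) *
      ((- 1) ^ (inv_sgn \<phi> + q) * (- 1) ^ (inv_sgn \<phi> + q)) *
      (?f * ?f / ((2 ^ (t - 1) * 2 ^ (t - 1)) * (?F * ?F))) *
      (?y powi (int h - int t + 1) * ?y powi (int h - int t + 1) / (?w * ?w))"
    unfolding Cntr_edge_real_commute Cntr_edge_real_eq
    by (simp add: divide_inverse ac_simps)
  also have "\<dots> = (- 1) ^ h * (- 1) ^ (n * (q + 1)) / of_nat t *
      (?f * ?f / (2 ^ (2 * t - 2) * (?F * ?F))) * (?y ^ (2 * h) / ?y ^ (2 * t - 2) / (?w * ?w))"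
    unfolding sgn two y_square power_add[of _ h] using t by simp
  also have "\<dots> = - Cntr_edge_complex n k a t i (phi n i)"
    unfolding Cntr_edge_complex_eq den_minus power_mult_distrib
    by (simp add: divide_inverse power2_eq_square ac_simps minus_one_power_iff)
  finally show ?thesis .
qed

end

section \<open>Parity of the exponent produced by reversing a real edge\<close>

lemma int_obtain_cong:
  fixes A B :: nat
  assumes "[A = B] (mod 4)"
  obtains u where "int A = int B + 4 * u"
proof -
  from assms have "int A mod 4 = int B mod 4"
    unfolding cong_def by (metis of_nat_mod of_nat_numeral)
  then obtain u where "int A - int B = 4 * u"
    by (auto simp: mod_eq_dvd_iff elim: dvdE)
  then show thesis by (intro that[of u]) simp
qed

lemma int_half: "int x = 2 * y \<Longrightarrow> int (x div 2) = y"
  by presburger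

text \<open>Modulo 4, A t + k is k (t + 1) = 2 k (q + 1), so its half has the parity of k (q + 1),
  which is that of n (q + 1). This settles the case \<open>Tau\<close>.\<close>

lemma even_orientation_exponent:
  fixes A k n t q :: nat
  assumes "[A = k] (mod 4)" "even (n + k)" "t = 2 * q + 1"
  shows "even ((A * t + k) div 2 + n * (q + 1))"
proof -
  obtain u where u: "int A = int k + 4 * u" using assms(1) by (rule int_obtain_cong)
  have "int (A * t + k) = 2 * (int (k * (q + 1)) + 2 * (u * int t))"
    using u assms(3) by (simp add: algebra_simps)
  then have "int ((A * t + k) div 2) = int (k * (q + 1)) + 2 * (u * int t)"
    by (rule int_half)
  then have "even (int ((A * t + k) div 2) + int (k * (q + 1)))"
    by presburger
  then have "even ((A * t + k) div 2 + k * (q + 1))" by presburger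
  then show ?thesis using assms(2) by auto
qed

text \<open>Modulo 4, A t + k is n + k + 2 n q, and 2 n q vanishes for even n. This settles the case
  \<open>Eta\<close>.\<close>

lemma even_orientation_exponent_iff:
  fixes A k n t q :: nat
  assumes "[A = n] (mod 4)" "even n" "even k" "t = 2 * q + 1"
  shows "even ((A * t + k) div 2 + n * (q + 1)) \<longleftrightarrow> even ((n + k) div 2)"
proof -
  obtain u where u: "int A = int n + 4 * u" using assms(1) by (rule int_obtain_cong)
  obtain n' k' where nk: "n = 2 * n'" "k = 2 * k'" using assms(2,3) by (elim evenE)
  have "int (A * t + k) = 2 * (int (n' + k') + 2 * (int n' * int q + u * int t))"
    using u assms(4) nk by (simp add: algebra_simps)
  then have "int ((A * t + k) div 2) = int (n' + k') + 2 * (int n' * int q + u * int t)"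
    by (rule int_half)
  then have "even (int ((A * t + k) div 2)) \<longleftrightarrow> even (int (n' + k'))"
    by presburger
  then have "even ((A * t + k) div 2) \<longleftrightarrow> even (n' + k')" by presburger
  then show ?thesis using nk by simp
qed

section \<open>Edge factors and edge types in the graph\<close>

definition real_factor :: "real_inv \<Rightarrow> nat \<Rightarrow> nat \<Rightarrow> (nat \<Rightarrow> nat) \<Rightarrow> ('v, 'e) dgraph \<Rightarrow> 'e \<Rightarrow> 'v \<Rightarrow>
  ratfun" where
  "real_factor \<phi> n k a G e v = Cntr_edge_real \<phi> n k a (edeg G e) (lab G v) (lab G (opp G e v))"

text \<open>The value at an edge of the graph is the same for either end, by
  \<open>complex_factor_commute\<close>.\<close>

definition edge_factor :: "nat \<Rightarrow> nat \<Rightarrow> (nat \<Rightarrow> nat) \<Rightarrow> ('v, 'e) dgraph \<Rightarrow> 'e \<Rightarrow> ratfun" where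
  "edge_factor n k a G e =
     (let v = SOME v. v \<in> ends G e in complex_factor n k a (edeg G e) (lab G v) (lab G (opp G e
       v)))"

text \<open>Closing the labels under \<open>phi\<close> makes the type invariant under both
  involutions; for a real edge it still determines the degree and the set of labels.\<close>

definition edge_type :: "nat \<Rightarrow> ('v, 'e) dgraph \<Rightarrow> 'e \<Rightarrow> nat \<times> nat set" where
  "edge_type n G e = (edeg G e, lab G ` ends G e \<union> phi n ` lab G ` ends G e)"

text \<open>The sign picked up by reversing a real edge; it is the same for all real edges.\<close>

definition reversal_sign :: "real_inv \<Rightarrow> nat \<Rightarrow> nat \<Rightarrow> ratfun" where
  "reversal_sign \<phi> n k = (if \<phi> = Tau then 1 else (- 1) ^ ((n + k) div 2))"

lemma reversal_sign_cases: "reversal_sign \<phi> n k = 1 \<or> \<phi> = Eta \<and> reversal_sign \<phi> n k = - 1"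
  by (cases \<phi>) (auto simp: reversal_sign_def minus_one_power_iff)

locale real_weighted_graph = real_graph n l G \<sigma>
  for n l :: nat and G :: "('v, 'e) dgraph" and \<sigma> +
  fixes \<phi> :: real_inv and k :: nat and a :: "nat \<Rightarrow> nat"
  assumes even_n_k: "even (n + k)"
    and odd_degrees: "c \<in> {1..k} \<Longrightarrow> odd (a c)"
    and Tau_cong: "\<phi> = Tau \<Longrightarrow> [(\<Sum>c=1..k. a c) = k] (mod 4)"
    and Eta_cong: "\<phi> = Eta \<Longrightarrow> even n \<and> [(\<Sum>c=1..k. a c) = n] (mod 4)"
begin

abbreviation rf :: "'e \<Rightarrow> 'v \<Rightarrow> ratfun" where "rf \<equiv> real_factor \<phi> n k a G"
abbreviation cf :: "'e \<Rightarrow> ratfun" where "cf \<equiv> edge_factor n k a G"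

lemma edge_factor_eq:
  assumes "e \<in> Edg G" "v \<in> ends G e"
  shows "cf e = complex_factor n k a (edeg G e) (lab G v) (lab G (opp G e v))"
proof -
  define w where "w = (SOME w. w \<in> ends G e)"
  have "w \<in> ends G e" unfolding w_def by (rule someI) fact
  then have "w = v \<or> w = opp G e v" using ends_opp[OF assms] by auto
  moreover have "opp G e (opp G e v) = v" by (rule opp_opp[OF assms])
  moreover have "complex_factor n k a (edeg G e) (lab G (opp G e v)) (lab G v) =
      complex_factor n k a (edeg G e) (lab G v) (lab G (opp G e v))"
    by (intro complex_factor_commute lab_range ends_in_Ver[OF assms] opp_in_Ver[OF assms])
  ultimately show ?thesis unfolding edge_factor_def Let_def w_def[symmetric] by auto
qed

lemma edge_factor_se:
  assumes "e \<in> Edg G"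
  shows "cf (se e) = cf e"
proof -
  from assms dgraph have "card (ends G e) = 2" by (simp add: is_dgraph_def)
  then obtain v where v: "v \<in> ends G e" by (auto simp: card_2_iff)
  have "sv v \<in> ends G (se e)" using v by (simp add: ends_se[OF assms])
  then have "cf (se e) = complex_factor n k a (edeg G e) (phi n (lab G v)) (phi n (lab G (opp G
    e v)))"
    by (simp add: edge_factor_eq[OF se_in_Edg[OF assms]] edeg_se[OF assms] opp_se[OF assms v]
        lab_sv ends_in_Ver[OF assms v] opp_in_Ver[OF assms v])
  also have "\<dots> = cf e"
    unfolding edge_factor_eq[OF assms v]
    by (intro complex_factor_phi lab_range ends_in_Ver[OF assms v] opp_in_Ver[OF assms v]
        lab_opp_neq[OF assms v] even_n_k odd_degrees)
  finally show ?thesis .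
qed

lemma edge_type_se:
  assumes "e \<in> Edg G"
  shows "edge_type n G (se e) = edge_type n G e"
proof -
  have lab: "lab G ` sv ` ends G e = phi n ` lab G ` ends G e"
    unfolding image_image using ends_in_Ver[OF assms] by (intro image_cong refl lab_sv)
  have "phi n ` phi n ` lab G ` ends G e = lab G ` ends G e"
    unfolding image_image using ends_in_Ver[OF assms] by (intro image_cong refl phi_phi lab_range)
  then show ?thesis
    by (simp add: edge_type_def ends_se[OF assms] edeg_se[OF assms] lab Un_commute)
qed

lemma lab_opp_real:
  assumes "e \<in> real_edges G \<sigma>" "v \<in> ends G e"
  shows "lab G (opp G e v) = phi n (lab G v)"
  using assms lab_sv[OF ends_in_Ver, of e v] by (simp add: real_edge_opp) (simp add: real_edges_def)

lemma edge_type_real: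
  assumes "e \<in> real_edges G \<sigma>"
  shows "edge_type n G e = (edeg G e, lab G ` ends G e)"
proof -
  have e: "e \<in> Edg G" using assms by (simp add: real_edges_def)
  have "phi n (lab G v) \<in> lab G ` ends G e" if "v \<in> ends G e" for v
    using lab_opp_real[OF assms that] opp_in_ends[OF e that] by (metis imageI)
  then show ?thesis by (auto simp: edge_type_def)
qed

lemma opposite_weights_real:
  assumes "e \<in> real_edges G \<sigma>" "v \<in> ends G e"
  shows "opposite_weights n k a (edeg G e) (edeg G e div 2) (lab G v)"
proof
  have "v \<in> Ver G" using assms by (intro ends_in_Ver) (auto simp: real_edges_def)
  then show "lab G v \<in> {1..n}" "lab G v \<noteq> 2 * (n div 2) + 1"
    by (rule lab_range lab_not_fixed)+
  show "edeg G e = 2 * (edeg G e div 2) + 1" using real_odd[OF assms(1)] by simp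
qed (rule odd_degrees)

lemma real_factor_opp:
  assumes "e \<in> real_edges G \<sigma>" "v \<in> ends G e"
  shows "rf e (opp G e v) = reversal_sign \<phi> n k * rf e v"
proof -
  let ?q = "edeg G e div 2" and ?A = "\<Sum>c=1..k. a c"
  interpret opposite_weights n k a "edeg G e" ?q "lab G v"
    by (rule opposite_weights_real[OF assms])
  have e: "e \<in> Edg G" using assms by (simp add: real_edges_def)
  have "(- 1 :: ratfun) ^ ((?A * edeg G e + k) div 2 + n * (?q + 1)) = reversal_sign \<phi> n k"
  proof (cases \<phi>)
    case Tau
    then show ?thesis
      using even_orientation_exponent[OF Tau_cong even_n_k t_eq] by (simp add: reversal_sign_def)
  next
    case Eta
    then have "even n" "even k" "[?A = n] (mod 4)" using Eta_cong even_n_k by auto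
    from even_orientation_exponent_iff[OF this(3,1,2) t_eq] Eta show ?thesis
      by (simp only: reversal_sign_def minus_one_power_iff real_inv.distinct if_False)
  qed
  then show ?thesis
    using Cntr_edge_real_commute[of \<phi>]
    by (simp only: real_factor_def opp_opp[OF e assms(2)] lab_opp_real[OF assms])
qed

lemma real_factor_mult:
  assumes "e \<in> real_edges G \<sigma>" "v \<in> ends G e"
  shows "of_nat (edeg G e) * rf e v * rf e (opp G e v) = - cf e"
proof -
  interpret opposite_weights n k a "edeg G e" "edeg G e div 2" "lab G v"
    by (rule opposite_weights_real[OF assms])
  have e: "e \<in> Edg G" using assms by (simp add: real_edges_def)
  \<comment> \<open>A real edge has odd degree, so it falls under the generic case of
    \<open>complex_factor\<close> although its labels are exchanged by \<open>phi\<close>.\<close>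
  show ?thesis
    using real_factors_mult[of \<phi>] real_odd[OF assms(1)]
    by (simp add: real_factor_def opp_opp[OF e assms(2)] lab_opp_real[OF assms]
        edge_factor_eq[OF e assms(2)] complex_factor_def)
qed

lemma real_factor_cases:
  assumes "e \<in> real_edges G \<sigma>" "v \<in> ends G e" "w \<in> ends G e"
  shows "\<exists>s\<in>{1, reversal_sign \<phi> n k}. rf e w = s * rf e v"
proof -
  have "w = v \<or> w = opp G e v" using ends_opp[of e v] assms by (auto simp: real_edges_def)
  then show ?thesis using real_factor_opp[OF assms(1,2)] by auto
qed

lemma Cntr_edge_real_edge:
  "e \<in> real_edges G \<sigma> \<Longrightarrow> Cntr_edge \<phi> n k a G \<sigma> fv e = rf e (fv e)"
  by (simp add: Cntr_edge_def real_factor_def)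

lemma Cntr_edge_complex_edge:
  "e \<in> complex_edges G \<sigma> \<Longrightarrow> fv e \<in> ends G e \<Longrightarrow> Cntr_edge \<phi> n k a G \<sigma> fv e = cf e"
  by (simp add: complex_edges_def Cntr_edge_def edge_factor_eq[of e "fv e"] complex_factor_def
    Let_def)

lemma prod_Cntr_edge:
  assumes "valid_choices G \<sigma> c"
  shows "(\<Prod>e\<in>real_edges G \<sigma> \<union> Ep c. Cntr_edge \<phi> n k a G \<sigma> (ori c) e) =
    (\<Prod>e\<in>real_edges G \<sigma>. rf e (ori c e)) * (\<Prod>e\<in>Ep c. cf e)"
proof -
  from assms have Ep: "Ep c \<subseteq> complex_edges G \<sigma>" and ori: "\<And>e. e \<in> Edg G \<Longrightarrow> ori c e \<in> ends G e"
    by (auto simp: valid_choices_def)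
  have sub: "real_edges G \<sigma> \<subseteq> Edg G" "Ep c \<subseteq> Edg G" using Ep by (auto simp: real_edges_def
    complex_edges_def)
  have "(\<Prod>e\<in>real_edges G \<sigma> \<union> Ep c. Cntr_edge \<phi> n k a G \<sigma> (ori c) e) =
      (\<Prod>e\<in>real_edges G \<sigma>. Cntr_edge \<phi> n k a G \<sigma> (ori c) e) * (\<Prod>e\<in>Ep c. Cntr_edge \<phi> n k a G \<sigma>
        (ori c) e)"
    using sub Ep finite_Edg by (intro prod.union_disjoint) (auto simp: complex_edges_def intro:
      finite_subset)
  also have "\<dots> = (\<Prod>e\<in>real_edges G \<sigma>. rf e (ori c e)) * (\<Prod>e\<in>Ep c. cf e)"
    using sub Ep ori by (intro arg_cong2[where f = "(*)"] prod.cong refl Cntr_edge_real_edge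
      Cntr_edge_complex_edge) auto
  finally show ?thesis .
qed

lemma complex_edges_subset: "complex_edges G \<sigma> \<subseteq> Edg G"
  by (auto simp: complex_edges_def)

lemma valid_choices_Ep:
  "valid_choices G \<sigma> c \<Longrightarrow> complex_edges G \<sigma> = Ep c \<union> se ` Ep c"
  "valid_choices G \<sigma> c \<Longrightarrow> Ep c \<inter> se ` Ep c = {}"
  by (auto simp: valid_choices_def)

lemma se_complex: "e \<in> complex_edges G \<sigma> \<Longrightarrow> se (se e) = e"
  and finite_complex: "finite (complex_edges G \<sigma>)"
  using finite_Edg by (auto simp: complex_edges_def se_se)

lemma prod_edge_factor:
  assumes "valid_choices G \<sigma> c"
  shows "(\<Prod>e\<in>Ep c. cf e) = (\<Prod>y\<in>cf ` Edg G. y ^ (card {e \<in> complex_edges G \<sigma>. cf e = y} div 2))"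
  using complex_edges_subset finite_Edg
  by (intro prod_transversal[OF finite_complex valid_choices_Ep[OF assms]] se_complex
    edge_factor_se) auto

lemma even_card_edge_type:
  assumes "valid_choices G \<sigma> c"
  shows "even (card {e \<in> complex_edges G \<sigma>. edge_type n G e = y})"
proof -
  have "card {e \<in> complex_edges G \<sigma>. edge_type n G e = y} = 2 * card {e \<in> Ep c. edge_type n G e
    = y}"
    using complex_edges_subset
    by (intro card_fibre_transversal[OF finite_complex valid_choices_Ep[OF assms]] se_complex
      edge_type_se) auto
  then show ?thesis by simp
qed

text \<open>The group is finite because \<open>permutes\<close> fixes everything outside of the
  graph; for an infinite set \<open>card\<close> would be 0 and the prefactor could not be
  cancelled.\<close>

lemma card_Aut_neq_0: "card (Aut l G \<sigma>) \<noteq> 0"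
proof -
  have "Aut l G \<sigma> \<subseteq> {p. p permutes Ver G} \<times> {p. p permutes Edg G}"
    by (auto simp: Aut_def graph_aut_def)
  moreover have "finite ({p. p permutes Ver G} \<times> {p. p permutes Edg G})"
    by (intro finite_cartesian_product finite_permutations finite_Ver finite_Edg)
  ultimately have "finite (Aut l G \<sigma>)" by (rule finite_subset)
  moreover have "(id, id) \<in> Aut l G \<sigma>"
    by (simp add: Aut_def graph_aut_def permutes_id)
  ultimately show ?thesis by auto
qed

lemma prod_Cntr_vertex:
  fixes M :: "('e + nat \<times> bool, 'h::comm_ring_1) mbar" and b p :: "nat \<Rightarrow> nat"
  assumes "mbar_theory M" "n \<ge> 1" "\<And>v. v \<in> Ver G \<Longrightarrow> k * genus G v = 0" "valid_choices G \<sigma> c"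
  defines "F \<equiv> \<lambda>v. (- 1) powi sgn_exp b p l G v * Cntr_vertex M n k a b p l G v"
  shows "(\<Prod>v\<in>Vp c. F v) = (\<Prod>y\<in>F ` Ver G. y ^ (card {v \<in> Ver G. F v = y} div 2))"
proof (rule prod_transversal[OF finite_Ver])
  show "Ver G = Vp c \<union> sv ` Vp c" "Vp c \<inter> sv ` Vp c = {}"
    using assms(4) by (auto simp: valid_choices_def)
  show "F (sv v) = F v" if "v \<in> Ver G" for v
  proof -
    \<comment> \<open>The sign exponent and the vertex factor change by the same sign, which squares
      to 1.\<close>
    have "(- 1 :: ratfun) ^ r * x * ((- 1) ^ r * y) = x * y" for r x y
      by (simp add: minus_one_power_iff)
    then show ?thesis
      unfolding F_def sgn_exp_sv[OF that] Cntr_vertex_sv[OF assms(1,2) even_n_k assms(3)[OF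
        that] that] .
  qed
qed (use sv_sv finite_Ver in auto)

end

section \<open>Comparison of the two contributions\<close>

lemma prod_signs:
  fixes s :: ratfun
  assumes "finite A" "s * s = 1" "\<And>x. x \<in> A \<Longrightarrow> \<exists>r\<in>{1, s}. f x = r * g x"
  shows "\<exists>r\<in>{1, s}. (\<Prod>x\<in>A. f x) = r * (\<Prod>x\<in>A. g x)"
  using assms(1,3)
proof (induction A rule: finite_induct)
  case (insert x A)
  then obtain r r' where r: "r \<in> {1, s}" "r' \<in> {1, s}" "f x = r * g x" "(\<Prod>x\<in>A. f x) = r' *
    (\<Prod>x\<in>A. g x)"
    by (metis insertI1 insertI2)
  have "r * r' \<in> {1, s}" using r(1,2) assms(2) by auto
  moreover have "(\<Prod>x\<in>insert x A. f x) = r * r' * (\<Prod>x\<in>insert x A. g x)"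
    using insert.hyps r(3,4) by simp
  ultimately show ?case by blast
qed simp

text \<open>Squares of odd numbers are 1 modulo 4, so in the case \<open>Tau\<close> the condition
  on the squares says that the sum of the degrees is congruent to \<open>k\<close>.\<close>

lemma real_weighted_graphI:
  assumes "even (int n - int k)"
    and "\<forall>i\<in>{1..k}. odd (a i)"
    and "\<phi> = Tau \<or> (even n \<and> \<phi> = Eta)"
    and "\<phi> = Tau \<Longrightarrow> [(\<Sum>i=1..k. (a i)\<^sup>2) = (\<Sum>i=1..k. a i)] (mod 4)"
    and "\<phi> = Eta \<Longrightarrow> [(\<Sum>i=1..k. a i) = n] (mod 4)"
    and "(G, \<sigma>) \<in> admissible_pairs g l n d"
  shows "real_weighted_graph n l G \<sigma> \<phi> k a"
proof
  show "is_dgraph n l G" "is_involution n l G \<sigma>"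
    and "\<And>e. e \<in> real_edges G \<sigma> \<Longrightarrow> odd (edeg G e)"
    and "\<And>v. v \<in> Ver G \<Longrightarrow> lab G v \<noteq> 2 * (n div 2) + 1"
    using assms(6) by (auto simp: admissible_pairs_def)
  show "even (n + k)" using assms(1) by simp
  show "\<And>c. c \<in> {1..k} \<Longrightarrow> odd (a c)" using assms(2) by blast
  show "\<phi> = Eta \<Longrightarrow> even n \<and> [(\<Sum>c=1..k. a c) = n] (mod 4)" using assms(3,5) by auto
  assume "\<phi> = Tau"
  have "[(\<Sum>c=1..k. (a c)\<^sup>2) = (\<Sum>c=1..k. 1)] (mod 4)"
  proof (rule cong_sum)
    fix c assume "c \<in> {1..k}"
    then obtain u where "a c = 2 * u + 1" using assms(2) by (blast elim: oddE)
    then have "(a c)\<^sup>2 = 1 + 4 * (u * u + u)" by (simp add: power2_eq_square algebra_simps)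
    then show "[(a c)\<^sup>2 = 1] (mod 4)" by (simp add: cong_def)
  qed
  with assms(4)[OF \<open>\<phi> = Tau\<close>] show "[(\<Sum>c=1..k. a c) = k] (mod 4)"
    by (auto intro: cong_trans cong_sym)
qed

theorem corollary4p8:
  fixes M :: "('e + nat \<times> bool, 'h::comm_ring_1) mbar"
    and \<phi> :: real_inv
    and n g d k l :: nat
    and a b p :: "nat \<Rightarrow> nat"
    and G :: "('v, 'e) dgraph"
    and \<sigma>1 \<sigma>2 :: "('v \<Rightarrow> 'v) \<times> ('e \<Rightarrow> 'e)"
    and c1 c2 :: "('v, 'e) choices"
    and e' :: 'e
  assumes "mbar_theory M"
    and "n \<ge> 1"
    and "even (int n - int k)"
    and "\<forall>i\<in>{1..k}. odd (a i)"
    and "\<phi> = Tau \<or> (even n \<and> \<phi> = Eta)"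
    and "\<phi> = Tau \<Longrightarrow> [(\<Sum>i=1..k. a i) = n] (mod 2)"
    and "\<phi> = Tau \<Longrightarrow> [(\<Sum>i=1..k. (a i)\<^sup>2) = (\<Sum>i=1..k. a i)] (mod 4)"
    and "\<phi> = Eta \<Longrightarrow> [(\<Sum>i=1..k. a i) = n] (mod 4)"
    and "(G, \<sigma>1) \<in> admissible_pairs g l n d"
    and "(G, \<sigma>2) \<in> admissible_pairs g l n d"
    and "\<forall>v\<in>Ver G. k * genus G v = 0"
    and "real_edges G \<sigma>1 \<supseteq> real_edges G \<sigma>2"
    and "card (real_edges G \<sigma>1 - real_edges G \<sigma>2) = 2"
    and "valid_choices G \<sigma>1 c1"
    and "valid_choices G \<sigma>2 c2"
    and "\<phi> = Eta \<Longrightarrow> Cntr_order_independent M \<phi> n k a l b p G \<sigma>1"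
    and "e' \<in> real_edges G \<sigma>1 - real_edges G \<sigma>2"
  shows "of_nat (edeg G e') * of_nat (card (Aut l G \<sigma>1)) * Cntr M \<phi> n k a l b p G \<sigma>1 c1
       = - (of_nat (card (Aut l G \<sigma>2)) * Cntr M \<phi> n k a l b p G \<sigma>2 c2)"
proof -
  interpret R1: real_weighted_graph n l G \<sigma>1 \<phi> k a
    using assms(3,4,5,7,8,9) by (rule real_weighted_graphI)
  interpret R2: real_weighted_graph n l G \<sigma>2 \<phi> k a
    using assms(3,4,5,7,8,10) by (rule real_weighted_graphI)
  let ?R1 = "real_edges G \<sigma>1" and ?R2 = "real_edges G \<sigma>2"
  let ?C1 = "complex_edges G \<sigma>1" and ?C2 = "complex_edges G \<sigma>2"
  let ?D = "?R1 - ?R2"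
  let ?rf = "real_factor \<phi> n k a G" and ?cf = "edge_factor n k a G"
  let ?s = "reversal_sign \<phi> n k"
  have genus: "\<And>v. v \<in> Ver G \<Longrightarrow> k * genus G v = 0" using assms(11) by blast
  have ori: "ori c1 e \<in> ends G e" "ori c2 e \<in> ends G e" if "e \<in> Edg G" for e
    using that assms(14,15) by (auto simp: valid_choices_def)
  have R1_Edg: "?R1 \<subseteq> Edg G" by (auto simp: real_edges_def)
  obtain e2 where D: "?D = {e', e2}" "e' \<noteq> e2"
  proof -
    have "card (?D - {e'}) = 1" using assms(13,17) by simp
    then obtain e2 where "?D - {e'} = {e2}" by (rule card_1_singletonE)
    then show thesis using assms(17) by (intro that[of e2]) blast+
  qed
  have C2: "?C2 = ?C1 \<union> ?D" "?C1 \<inter> ?D = {}"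
    using R1_Edg assms(12) by (auto simp: complex_edges_def)
  have card_C2: "card {e \<in> ?C2. P e} = card {e \<in> ?C1. P e} + card {e \<in> ?D. P e}" for P
  proof -
    have "{e \<in> ?C2. P e} = {e \<in> ?C1. P e} \<union> {e \<in> ?D. P e}" using C2 by blast
    also have "card \<dots> = card {e \<in> ?C1. P e} + card {e \<in> ?D. P e}"
      using C2(2) R1.finite_complex D(1) by (intro card_Un_disjoint) auto
    finally show ?thesis .
  qed
  have real: "e' \<in> ?R1" "e2 \<in> ?R1" "e' \<in> Edg G" "e2 \<in> Edg G"
    using D R1_Edg by auto

  \<comment> \<open>\<open>\<sigma>2\<close> need not interchange \<open>e'\<close> and \<open>e2\<close>, but the edges of each type
    outside \<open>?R1\<close> and outside \<open>?R2\<close> are even in number, hence also those in \<open>?D\<close>.\<close>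
  have type: "edge_type n G e2 = edge_type n G e'"
  proof (rule ccontr)
    assume "edge_type n G e2 \<noteq> edge_type n G e'"
    then have "{e \<in> ?D. edge_type n G e = edge_type n G e'} = {e'}" using D by auto
    then have "card {e \<in> ?C2. edge_type n G e = edge_type n G e'} =
        card {e \<in> ?C1. edge_type n G e = edge_type n G e'} + 1" by (simp only: card_C2) simp
    with R1.even_card_edge_type[OF assms(14), of "edge_type n G e'"]
      R2.even_card_edge_type[OF assms(15), of "edge_type n G e'"]
    show False by presburger
  qed
  have deg: "edeg G e2 = edeg G e'" and lab: "lab G ` ends G e2 = lab G ` ends G e'"
    using type real by (simp_all add: R1.edge_type_real)
  define v where "v = ori c1 e'"
  have v: "v \<in> ends G e'" unfolding v_def by (rule ori) fact
  \<comment> \<open>The factor of \<open>e2\<close> in its chosen orientation is read off at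
    \<open>e'\<close>, from the end with the matching label.\<close>
  obtain w where w: "w \<in> ends G e'" "lab G w = lab G (ori c1 e2)"
    using lab ori(1)[OF real(4)] by (metis imageE imageI)
  have lab_opp: "lab G (opp G e2 (ori c1 e2)) = lab G (opp G e' w)"
    using R1.lab_opp_real[OF real(1) w(1)] R1.lab_opp_real[OF real(2) ori(1)[OF real(4)]] w(2)
      by simp
  have rf_e2: "?rf e2 (ori c1 e2) = ?rf e' w"
    by (simp add: real_factor_def deg w(2) lab_opp)
  have cf_e2: "?cf e2 = ?cf e'"
    by (simp add: R1.edge_factor_eq[OF real(4) ori(1)[OF real(4)]] R1.edge_factor_eq[OF real(3)
      w(1)]
        deg w(2) lab_opp)

  have prod_Ep: "(\<Prod>e\<in>Ep c2. ?cf e) = ?cf e' * (\<Prod>e\<in>Ep c1. ?cf e)"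
  proof -
    \<comment> \<open>Both edges of \<open>?D\<close> take the value \<open>?cf e'\<close>, which
      adds 2 to that fibre and 1 to its exponent.\<close>
    have "card {e \<in> ?C2. ?cf e = y} div 2 = card {e \<in> ?C1. ?cf e = y} div 2 + (if y = ?cf e'
      then 1 else 0)" for y
    proof (cases "y = ?cf e'")
      case True
      then have D_y: "{e \<in> ?D. ?cf e = y} = {e', e2}" using D cf_e2 by auto
      show ?thesis unfolding card_C2 D_y using True D(2) by simp
    next
      case False
      then have D_y: "{e \<in> ?D. ?cf e = y} = {}" using D cf_e2 by auto
      show ?thesis unfolding card_C2 D_y using False by simp
    qed
    then have "(\<Prod>e\<in>Ep c2. ?cf e) = (\<Prod>y\<in>?cf ` Edg G. y ^ (card {e \<in> ?C1. ?cf e = y} div 2)) *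
        (\<Prod>y\<in>?cf ` Edg G. if y = ?cf e' then y else 1)"
      unfolding R2.prod_edge_factor[OF assms(15)]
      by (simp only: power_add prod.distrib) (simp add: if_distrib cong: if_cong)
    also have "(\<Prod>y\<in>?cf ` Edg G. if y = ?cf e' then y else 1) = ?cf e'"
      using R1.finite_Edg real(3) by (simp add: prod.delta)
    finally show ?thesis unfolding R1.prod_edge_factor[OF assms(14)] by (simp only: mult.commute)
  qed

  have s_square: "?s * ?s = 1" using reversal_sign_cases[of \<phi> n k] by auto
  \<comment> \<open>The product formula calls for the end opposite to \<open>v\<close>, whereas
    \<open>w\<close> may be \<open>v\<close> itself; \<open>r1\<close> records the discrepancy.
    Likewise \<open>r2\<close> below compares the orientations of the common real edges in
    \<open>c1\<close> and \<open>c2\<close>.\<close>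
  obtain r1 where r1: "r1 \<in> {1, ?s}" "?rf e' w = r1 * ?rf e' (opp G e' v)"
    using R1.real_factor_cases[OF real(1) R1.opp_in_ends[OF real(3) v] w(1)] by blast
  have "\<exists>r\<in>{1, ?s}. (\<Prod>e\<in>?R2. ?rf e (ori c1 e)) = r * (\<Prod>e\<in>?R2. ?rf e (ori c2 e))"
  proof (rule prod_signs[OF _ s_square])
    show "finite ?R2" using R2.finite_Edg by (simp add: real_edges_def)
    fix e assume "e \<in> ?R2"
    moreover from this have "e \<in> Edg G" by (simp add: real_edges_def)
    ultimately show "\<exists>r\<in>{1, ?s}. ?rf e (ori c1 e) = r * ?rf e (ori c2 e)"
      by (intro R2.real_factor_cases ori)
  qed
  then obtain r2 where r2: "r2 \<in> {1, ?s}"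
    "(\<Prod>e\<in>?R2. ?rf e (ori c1 e)) = r2 * (\<Prod>e\<in>?R2. ?rf e (ori c2 e))" by blast
  define P1 where "P1 = (\<Prod>e\<in>?R1 \<union> Ep c1. Cntr_edge \<phi> n k a G \<sigma>1 (ori c1) e)"
  define P2 where "P2 = (\<Prod>e\<in>?R2 \<union> Ep c2. Cntr_edge \<phi> n k a G \<sigma>2 (ori c2) e)"
  have P: "of_nat (edeg G e') * P1 = - (r1 * r2) * P2"
  proof -
    have "?R1 = insert e' (insert e2 ?R2)" "e' \<notin> insert e2 ?R2" "e2 \<notin> ?R2" "finite ?R2"
      using D assms(12) R2.finite_Edg by (auto simp: real_edges_def)
    then have "(\<Prod>e\<in>?R1. ?rf e (ori c1 e)) = ?rf e' v * (?rf e' w * (\<Prod>e\<in>?R2. ?rf e (ori c1 e)))"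
      by (simp add: v_def rf_e2)
    then have "of_nat (edeg G e') * P1 =
        (of_nat (edeg G e') * ?rf e' v * ?rf e' (opp G e' v)) *
        (r1 * r2 * (\<Prod>e\<in>?R2. ?rf e (ori c2 e)) * (\<Prod>e\<in>Ep c1. ?cf e))"
      unfolding P1_def R1.prod_Cntr_edge[OF assms(14)] r1(2) r2(2) by (simp add: ac_simps)
    also have "\<dots> = - (r1 * r2) * ((\<Prod>e\<in>?R2. ?rf e (ori c2 e)) * (?cf e' * (\<Prod>e\<in>Ep c1. ?cf e)))"
      unfolding R1.real_factor_mult[OF real(1) v] by (simp add: ac_simps)
    also have "\<dots> = - (r1 * r2) * P2"
      unfolding P2_def R2.prod_Cntr_edge[OF assms(15)] prod_Ep ..
    finally show ?thesis .
  qed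

  let ?F = "\<lambda>v. (- 1) powi sgn_exp b p l G v * Cntr_vertex M n k a b p l G v"
  define V where "V = (\<Prod>v\<in>Vp c1. ?F v)"
  have V: "(\<Prod>v\<in>Vp c2. ?F v) = V"
    unfolding V_def
    by (rule trans[OF R2.prod_Cntr_vertex[OF assms(1,2) genus assms(15)]
          R1.prod_Cntr_vertex[OF assms(1,2) genus assms(14), symmetric]])
  have Cntr1: "of_nat (card (Aut l G \<sigma>1)) * Cntr M \<phi> n k a l b p G \<sigma>1 c1 = V * P1"
    unfolding Cntr_def V_def[symmetric] P1_def[symmetric] using R1.card_Aut_neq_0 by simp
  have Cntr2: "of_nat (card (Aut l G \<sigma>2)) * Cntr M \<phi> n k a l b p G \<sigma>2 c2 = V * P2"
    unfolding Cntr_def V P2_def[symmetric] using R2.card_Aut_neq_0 by simp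
  have VP: "of_nat (edeg G e') * (V * P1) = - (r1 * r2) * (V * P2)"
    by (simp only: mult.left_commute[of _ V] P)
  have "of_nat (edeg G e') * (V * P1) = - (V * P2)"
  proof (cases "?s = 1")
    case True
    then have "r1 * r2 = 1" using r1(1) r2(1) by auto
    with VP show ?thesis by simp
  next
    case False
    with reversal_sign_cases[of \<phi> n k] have s: "\<phi> = Eta" "?s = - 1" by auto
    \<comment> \<open>The same choices with \<open>e'\<close> alone reversed: a single sign change,
      so order independence equates the contribution with its own negative.\<close>
    let ?c = "c1\<lparr>ori := (ori c1)(e' := opp G e' v)\<rparr>"
    have c: "valid_choices G \<sigma>1 ?c"
      using assms(14) R1.opp_in_ends[OF real(3) v] by (auto simp: valid_choices_def)
    have "(\<Prod>e\<in>?R1. ?rf e (ori ?c e)) = - (\<Prod>e\<in>?R1. ?rf e (ori c1 e))"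
    proof -
      have "finite ?R1" using R1.finite_Edg by (simp add: real_edges_def)
      note split = prod.remove[OF this real(1)]
      have rest: "(\<Prod>e\<in>?R1 - {e'}. ?rf e (ori ?c e)) = (\<Prod>e\<in>?R1 - {e'}. ?rf e (ori c1 e))"
        by (intro prod.cong refl) simp
      have flip: "?rf e' (ori ?c e') = - ?rf e' (ori c1 e')"
        using R1.real_factor_opp[OF real(1) v] s(2) by (simp add: v_def)
      show ?thesis by (simp only: split rest flip mult_minus_left)
    qed
    moreover have "Vp ?c = Vp c1" "Ep ?c = Ep c1" by simp_all
    ultimately have neg: "Cntr M \<phi> n k a l b p G \<sigma>1 ?c = - Cntr M \<phi> n k a l b p G \<sigma>1 c1"
      unfolding Cntr_def R1.prod_Cntr_edge[OF c] R1.prod_Cntr_edge[OF assms(14)]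
      by (simp only: mult_minus_left mult_minus_right)
    have "Cntr M \<phi> n k a l b p G \<sigma>1 ?c = Cntr M \<phi> n k a l b p G \<sigma>1 c1"
      using assms(16)[OF s(1), unfolded Cntr_order_independent_def, rule_format, OF c assms(14)]
      by simp
    then have "Cntr M \<phi> n k a l b p G \<sigma>1 c1 + Cntr M \<phi> n k a l b p G \<sigma>1 c1 = 0"
      unfolding neg by (metis add.left_inverse)
    then have "of_nat 2 * Cntr M \<phi> n k a l b p G \<sigma>1 c1 = 0" by (simp only: of_nat_numeral mult_2)
    then have "Cntr M \<phi> n k a l b p G \<sigma>1 c1 = 0"
      by (simp only: mult_eq_0_iff of_nat_ratfun_eq_0_iff) simp
    then have VP1: "V * P1 = 0" using Cntr1 by simp
    \<comment> \<open>Order independence is assumed for \<open>\<sigma>1\<close> only; the relation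
      \<open>VP\<close> with its nonzero signs carries the vanishing over to
      \<open>\<sigma>2\<close>.\<close>
    have "r1 \<noteq> 0" "r2 \<noteq> 0" using r1(1) r2(1) s(2) by auto
    with VP VP1 have VP2: "V * P2 = 0" by simp
    show ?thesis unfolding VP1 VP2 by simp
  qed
  then show ?thesis unfolding Cntr2 mult.assoc Cntr1 .
qed

end
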